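(* Let $A$ be a connected, $\mathbb{N}$-graded, locally finite-dimensional algebra over a field $k$, and let $f\in A_+$ be a homogeneous normal regular element with normalizing automorphism $\sigma$. Let $\zeta=\{\sigma^n\mid n\in\mathbb{Z}\}$ be the twisting system associated with $\sigma$, and let $A^\zeta$ be the corresponding Zhang twist of $A$. Then the categories $TMF_A(f)$ and $TMF_{A^\zeta}(f)$ are equivalent.
   Context: Conventions. $A=\bigoplus_{n\ge 0}A_n$ with $A_0=k$, $\dim_k A_i<\infty$, $A_+=\bigoplus_{n>0}A_n$. Modules are graded left modules and homomorphisms have degree $0$; $M(n)_i=M_{i+n}$. Regular means non-zero-divisor (on both sides); normal means $fA=Af$. The normalizing automorphism $\sigma$ of $f$ is the graded algebra automorphism with $af=f\sigma(a)$ for all $a$. $M^\sigma$ is $M$ as a graded abelian group with action $a\cdot m=\sigma(a)m$. Put $M^{tw}=M^{\sigma}(-\deg f)$ and $\varphi^{tw}=\varphi$ on underlying groups. Left multiplication by $f$ is a degree $0$ homomorphism $\lambda_f^M:M^{tw}\to M$. A twisted left matrix factorization of $f$ over $A$ is a pair $(\varphi:F\to G,\ \tau:G^{tw}\to F)$ of degree $0$ maps of finitely generated graded free left $A$-modules with $\varphi\tau=\lambda_f^G$ and $\tau\varphi^{tw}=\lambda_f^F$. A morphism $(\varphi,\tau)\to(\varphi',\tau')$ is a pair of degree $0$ homomorphisms $\Psi_G:G\to G'$, $\Psi_F:F\to F'$ with $\Psi_G\varphi=\varphi'\Psi_F$. $TMF_A(f)$ is the category of twisted left matrix factorizations of $f$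 over $A$. The Zhang twist $A^\zeta$ for $\zeta=\{\sigma^n\}$ is the graded $k$-algebra equal to $A$ as a graded vector space, with multiplication $x\ast y=\sigma^{m}(x)y$ for $x\in A_\ell$, $y\in A_m$. The element $f$ is again normal and regular in $A^\zeta$; let $\hat\sigma$ be its normalizing automorphism in $A^\zeta$, i.e. the graded algebra automorphism of $A^\zeta$ with $a\ast f=f\ast\hat\sigma(a)$ for all $a$. For a graded left $A^\zeta$-module $M$ put $M^{\hat{tw}}=M^{\hat\sigma}(-\deg f)$, where $M^{\hat\sigma}$ is $M$ as a graded abelian group with each $a\in A^\zeta$ acting as $\hat\sigma(a)$ does on $M$, put $\varphi^{\hat{tw}}=\varphi$ on underlying groups, and let $\lambda_f^M:M^{\hat{tw}}\to M$ be the action of $f\in A^\zeta$. $TMF_{A^\zeta}(f)$ is the category whose objects are pairs $(\varphi:F\to G,\ \tau:G^{\hat{tw}}\to F)$ of degree $0$ maps of finitely generated graded free left $A^\zeta$-modules with $\varphi\tau=\lambda_f^G$ and $\tau\varphi^{\hat{tw}}=\lambda_f^F$, and whose morphisms $(\varphi,\tau)\to(\varphi',\tau')$ are pairs of degree $0$ $A^\zeta$-module homomorphisms $\Psi_G:G\to G'$, $\Psi_F:F\to F'$ with $\Psi_G\varphi=\varphi'\Psi_F$. *)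

theory Defs
  imports "HOL-Algebra.Algebra"
begin

section \<open>Categories and equivalences\<close>

text \<open>Hom-sets need not be disjoint, so arrows do not determine their ends; hence composition and
  the arrow part of a functor take the objects as explicit arguments.  \<open>Comp C U V W h g\<close> is
  \<open>h\<close> after \<open>g\<close>, for \<open>g\<close> in \<open>Hom C U V\<close> and \<open>h\<close> in \<open>Hom C V W\<close>.\<close>

record ('o, 'm) cat =
  Obj :: "'o set"
  Hom :: "'o \<Rightarrow> 'o \<Rightarrow> 'm set"
  Id :: "'o \<Rightarrow> 'm"
  Comp :: "'o \<Rightarrow> 'o \<Rightarrow> 'o \<Rightarrow> 'm \<Rightarrow> 'm \<Rightarrow> 'm"

locale category =
  fixes C :: "('o, 'm) cat"
  assumes Id_in_Hom: "U \<in> Obj C \<Longrightarrow> Id C U \<in> Hom C U U"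
    and Comp_in_Hom: "\<lbrakk>U \<in> Obj C; V \<in> Obj C; W \<in> Obj C; g \<in> Hom C U V; h \<in> Hom C V W\<rbrakk>
      \<Longrightarrow> Comp C U V W h g \<in> Hom C U W"
    and Comp_Id_right: "\<lbrakk>U \<in> Obj C; V \<in> Obj C; g \<in> Hom C U V\<rbrakk> \<Longrightarrow> Comp C U U V g (Id C U) = g"
    and Comp_Id_left: "\<lbrakk>U \<in> Obj C; V \<in> Obj C; g \<in> Hom C U V\<rbrakk> \<Longrightarrow> Comp C U V V (Id C V) g = g"
    and Comp_assoc: "\<lbrakk>T \<in> Obj C; U \<in> Obj C; V \<in> Obj C; W \<in> Obj C;
        g \<in> Hom C T U; h \<in> Hom C U V; k \<in> Hom C V W\<rbrakk>
      \<Longrightarrow> Comp C T V W k (Comp C T U V h g) = Comp C T U W (Comp C U V W k h) g"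

locale cat_functor = C: category C + D: category D
  for C :: "('o, 'm) cat" and D :: "('p, 'n) cat" +
  fixes Fo :: "'o \<Rightarrow> 'p" and Fm :: "'o \<Rightarrow> 'o \<Rightarrow> 'm \<Rightarrow> 'n"
  assumes Fo_in_Obj: "U \<in> Obj C \<Longrightarrow> Fo U \<in> Obj D"
    and Fm_in_Hom: "\<lbrakk>U \<in> Obj C; V \<in> Obj C; g \<in> Hom C U V\<rbrakk> \<Longrightarrow> Fm U V g \<in> Hom D (Fo U) (Fo V)"
    and Fm_Id: "U \<in> Obj C \<Longrightarrow> Fm U U (Id C U) = Id D (Fo U)"
    and Fm_Comp: "\<lbrakk>U \<in> Obj C; V \<in> Obj C; W \<in> Obj C; g \<in> Hom C U V; h \<in> Hom C V W\<rbrakk>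
      \<Longrightarrow> Fm U W (Comp C U V W h g) = Comp D (Fo U) (Fo V) (Fo W) (Fm V W h) (Fm U V g)"

definition is_iso :: "('o, 'm) cat \<Rightarrow> 'o \<Rightarrow> 'o \<Rightarrow> 'm \<Rightarrow> bool" where
  "is_iso C U V g \<longleftrightarrow> g \<in> Hom C U V \<and>
     (\<exists>h \<in> Hom C V U. Comp C U V U h g = Id C U \<and> Comp C V U V g h = Id C V)"

locale natural_iso = F: cat_functor C D Fo Fm + G: cat_functor C D Go Gm
  for C :: "('o, 'm) cat" and D :: "('p, 'n) cat" and Fo Fm Go Gm +
  fixes \<eta> :: "'o \<Rightarrow> 'n"
  assumes component_iso: "U \<in> Obj C \<Longrightarrow> is_iso D (Fo U) (Go U) (\<eta> U)"
    and naturality: "\<lbrakk>U \<in> Obj C; V \<in> Obj C; g \<in> Hom C U V\<rbrakk>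
      \<Longrightarrow> Comp D (Fo U) (Fo V) (Go V) (\<eta> V) (Fm U V g)
        = Comp D (Fo U) (Go U) (Go V) (Gm U V g) (\<eta> U)"

definition equivalent_categories :: "('o, 'm) cat \<Rightarrow> ('p, 'n) cat \<Rightarrow> bool" where
  "equivalent_categories C D \<longleftrightarrow> category C \<and> category D \<and>
     (\<exists>Fo Fm Go Gm \<eta> \<epsilon>.
        cat_functor C D Fo Fm \<and> cat_functor D C Go Gm \<and>
        natural_iso C C (\<lambda>U. U) (\<lambda>U V g. g)
          (\<lambda>U. Go (Fo U)) (\<lambda>U V g. Gm (Fo U) (Fo V) (Fm U V g)) \<eta> \<and>
        natural_iso D D (\<lambda>U. Fo (Go U)) (\<lambda>U V g. Fm (Go U) (Go V) (Gm U V g))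
          (\<lambda>U. U) (\<lambda>U V g. g) \<epsilon>)"


section \<open>Graded algebras and graded modules\<close>

text \<open>An \<open>('i, 'r, 'm) graded_module\<close> is graded by \<open>'i\<close>, with scalars from \<open>'r\<close>.  Algebras over
  a field are graded by \<^typ>\<open>nat\<close> and use all fields of the record; modules over them are graded by
  \<^typ>\<open>int\<close>, and for them the inherited fields \<^const>\<open>mult\<close> and \<^const>\<open>one\<close> have no meaning.\<close>

record ('i, 'r, 'm) graded_module = "('r, 'm) module" +
  grade :: "'i \<Rightarrow> 'm set"

definition is_decomposition :: "('i, 'r, 'm) graded_module \<Rightarrow> 'm \<Rightarrow> ('i \<Rightarrow> 'm) \<Rightarrow> bool" where
  "is_decomposition M x c \<longleftrightarrow> (\<forall>i. c i \<in> grade M i) \<and> finite {i. c i \<noteq> \<zero>\<^bsub>M\<^esub>} \<and>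
     x = (\<Oplus>\<^bsub>M\<^esub>i\<in>{i. c i \<noteq> \<zero>\<^bsub>M\<^esub>}. c i)"

definition direct_sum_of_grades :: "('i, 'r, 'm) graded_module \<Rightarrow> bool" where
  "direct_sum_of_grades M \<longleftrightarrow> (\<forall>i. additive_subgroup (grade M i) M) \<and>
     (\<forall>x \<in> carrier M. \<exists>!c. is_decomposition M x c)"

definition component :: "('i, 'r, 'm) graded_module \<Rightarrow> 'm \<Rightarrow> 'i \<Rightarrow> 'm" where
  "component M x = (THE c. is_decomposition M x c)"

text \<open>The library's locale \<^locale>\<open>algebra\<close> is restricted to commutative algebras.\<close>

locale connected_graded_algebra = K: field K + A: ring A + vs: module K A
  for K :: "'k ring" and A :: "(nat, 'k, 'a) graded_module" +
  assumes smult_mult_left: "\<lbrakk>c \<in> carrier K; x \<in> carrier A; y \<in> carrier A\<rbrakk>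
      \<Longrightarrow> (c \<odot>\<^bsub>A\<^esub> x) \<otimes>\<^bsub>A\<^esub> y = c \<odot>\<^bsub>A\<^esub> (x \<otimes>\<^bsub>A\<^esub> y)"
    and smult_mult_right: "\<lbrakk>c \<in> carrier K; x \<in> carrier A; y \<in> carrier A\<rbrakk>
      \<Longrightarrow> x \<otimes>\<^bsub>A\<^esub> (c \<odot>\<^bsub>A\<^esub> y) = c \<odot>\<^bsub>A\<^esub> (x \<otimes>\<^bsub>A\<^esub> y)"
    and grade_submodule: "submodule (grade A i) K A"
    and direct_sum: "direct_sum_of_grades A"
    and grade_mult: "\<lbrakk>x \<in> grade A i; y \<in> grade A j\<rbrakk> \<Longrightarrow> x \<otimes>\<^bsub>A\<^esub> y \<in> grade A (i + j)"
    and connected: "bij_betw (\<lambda>c. c \<odot>\<^bsub>A\<^esub> \<one>\<^bsub>A\<^esub>) (carrier K) (grade A 0)"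
    and locally_finite: "\<exists>B. finite B \<and> B \<subseteq> grade A i \<and>
      (\<forall>x \<in> grade A i. \<exists>c \<in> B \<rightarrow> carrier K. x = (\<Oplus>\<^bsub>A\<^esub>b\<in>B. c b \<odot>\<^bsub>A\<^esub> b))"

definition regular_element :: "('a, 'b) ring_scheme \<Rightarrow> 'a \<Rightarrow> bool" where
  "regular_element A f \<longleftrightarrow> f \<in> carrier A \<and>
     (\<forall>a \<in> carrier A. (f \<otimes>\<^bsub>A\<^esub> a = \<zero>\<^bsub>A\<^esub> \<longrightarrow> a = \<zero>\<^bsub>A\<^esub>) \<and> (a \<otimes>\<^bsub>A\<^esub> f = \<zero>\<^bsub>A\<^esub> \<longrightarrow> a = \<zero>\<^bsub>A\<^esub>))"

definition normal_element :: "('a, 'b) ring_scheme \<Rightarrow> 'a \<Rightarrow> bool" where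
  "normal_element A f \<longleftrightarrow> f \<in> carrier A \<and>
     (\<lambda>a. f \<otimes>\<^bsub>A\<^esub> a) ` carrier A = (\<lambda>a. a \<otimes>\<^bsub>A\<^esub> f) ` carrier A"

text \<open>The degree of a nonzero homogeneous element.\<close>

definition deg_of :: "(nat, 'k, 'a) graded_module \<Rightarrow> 'a \<Rightarrow> nat" where
  "deg_of A x = (THE n. x \<in> grade A n)"

text \<open>Automorphisms are taken undefined outside the carrier (part of \<^const>\<open>Bij\<close>), so that they
  are determined by their values on the carrier.\<close>

definition graded_algebra_auts :: "'k ring \<Rightarrow> (nat, 'k, 'a) graded_module \<Rightarrow> ('a \<Rightarrow> 'a) set" where
  "graded_algebra_auts K A = {\<sigma> \<in> Bij (carrier A). \<sigma> \<in> ring_hom A A \<and>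
     (\<forall>c \<in> carrier K. \<forall>a \<in> carrier A. \<sigma> (c \<odot>\<^bsub>A\<^esub> a) = c \<odot>\<^bsub>A\<^esub> \<sigma> a) \<and>
     (\<forall>i. \<sigma> ` grade A i = grade A i)}"

text \<open>For a homogeneous normal regular \<open>f\<close>, exactly one automorphism satisfies the description.\<close>

definition normalizing_automorphism ::
    "'k ring \<Rightarrow> (nat, 'k, 'a) graded_module \<Rightarrow> 'a \<Rightarrow> 'a \<Rightarrow> 'a" where
  "normalizing_automorphism K A f = (THE \<sigma>. \<sigma> \<in> graded_algebra_auts K A \<and>
     (\<forall>a \<in> carrier A. a \<otimes>\<^bsub>A\<^esub> f = f \<otimes>\<^bsub>A\<^esub> \<sigma> a))"

definition twisting_system_of ::
    "(nat, 'k, 'a) graded_module \<Rightarrow> ('a \<Rightarrow> 'a) \<Rightarrow> int \<Rightarrow> 'a \<Rightarrow> 'a" where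
  "twisting_system_of A \<sigma> n = \<sigma> [^]\<^bsub>BijGroup (carrier A)\<^esub> n"

text \<open>The twisted product of \<open>x\<close> with a homogeneous \<open>y\<close> of degree \<open>m\<close> is \<open>\<zeta> m x \<otimes> y\<close>; the sum
  below extends this to all \<open>y\<close> by additivity.\<close>

definition zhang_twist ::
    "(nat, 'k, 'a) graded_module \<Rightarrow> (int \<Rightarrow> 'a \<Rightarrow> 'a) \<Rightarrow> (nat, 'k, 'a) graded_module" where
  "zhang_twist A \<zeta> = A\<lparr>mult := \<lambda>x y.
     \<Oplus>\<^bsub>A\<^esub>m\<in>{m. component A y m \<noteq> \<zero>\<^bsub>A\<^esub>}. \<zeta> (int m) x \<otimes>\<^bsub>A\<^esub> component A y m\<rparr>"

text \<open>The library's locale \<^locale>\<open>module\<close> requires a commutative ring of scalars.\<close>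

locale graded_left_module = A: ring A + M: abelian_group M
  for A :: "(nat, 'k, 'a) graded_module" and M :: "(int, 'a, 'm) graded_module" +
  assumes smult_closed: "\<lbrakk>a \<in> carrier A; x \<in> carrier M\<rbrakk> \<Longrightarrow> a \<odot>\<^bsub>M\<^esub> x \<in> carrier M"
    and smult_l_distr: "\<lbrakk>a \<in> carrier A; b \<in> carrier A; x \<in> carrier M\<rbrakk>
      \<Longrightarrow> (a \<oplus>\<^bsub>A\<^esub> b) \<odot>\<^bsub>M\<^esub> x = a \<odot>\<^bsub>M\<^esub> x \<oplus>\<^bsub>M\<^esub> b \<odot>\<^bsub>M\<^esub> x"
    and smult_r_distr: "\<lbrakk>a \<in> carrier A; x \<in> carrier M; y \<in> carrier M\<rbrakk>
      \<Longrightarrow> a \<odot>\<^bsub>M\<^esub> (x \<oplus>\<^bsub>M\<^esub> y) = a \<odot>\<^bsub>M\<^esub> x \<oplus>\<^bsub>M\<^esub> a \<odot>\<^bsub>M\<^esub> y"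
    and smult_assoc: "\<lbrakk>a \<in> carrier A; b \<in> carrier A; x \<in> carrier M\<rbrakk>
      \<Longrightarrow> (a \<otimes>\<^bsub>A\<^esub> b) \<odot>\<^bsub>M\<^esub> x = a \<odot>\<^bsub>M\<^esub> (b \<odot>\<^bsub>M\<^esub> x)"
    and smult_one: "x \<in> carrier M \<Longrightarrow> \<one>\<^bsub>A\<^esub> \<odot>\<^bsub>M\<^esub> x = x"
    and direct_sum: "direct_sum_of_grades M"
    and grade_smult: "\<lbrakk>a \<in> grade A i; x \<in> grade M j\<rbrakk> \<Longrightarrow> a \<odot>\<^bsub>M\<^esub> x \<in> grade M (int i + j)"

text \<open>Graded free of finite rank: there is a finite basis of homogeneous elements.\<close>

definition fg_graded_free ::
    "(nat, 'k, 'a) graded_module \<Rightarrow> (int, 'a, 'm) graded_module \<Rightarrow> bool" where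
  "fg_graded_free A M \<longleftrightarrow> graded_left_module A M \<and>
     (\<exists>B. finite B \<and> B \<subseteq> (\<Union>i. grade M i) \<and>
       (\<forall>x \<in> carrier M. \<exists>!c. c \<in> B \<rightarrow>\<^sub>E carrier A \<and> x = (\<Oplus>\<^bsub>M\<^esub>b\<in>B. c b \<odot>\<^bsub>M\<^esub> b)))"

text \<open>Homomorphisms are extensional, so that equality of functions is equality of homomorphisms.\<close>

definition graded_hom :: "(nat, 'k, 'a) graded_module \<Rightarrow> (int, 'a, 'm) graded_module
    \<Rightarrow> (int, 'a, 'n) graded_module \<Rightarrow> ('m \<Rightarrow> 'n) set" where
  "graded_hom A M N = {\<phi> \<in> carrier M \<rightarrow>\<^sub>E carrier N.
     (\<forall>x \<in> carrier M. \<forall>y \<in> carrier M. \<phi> (x \<oplus>\<^bsub>M\<^esub> y) = \<phi> x \<oplus>\<^bsub>N\<^esub> \<phi> y) \<and>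
     (\<forall>a \<in> carrier A. \<forall>x \<in> carrier M. \<phi> (a \<odot>\<^bsub>M\<^esub> x) = a \<odot>\<^bsub>N\<^esub> \<phi> x) \<and>
     (\<forall>i. \<phi> ` grade M i \<subseteq> grade N i)}"

definition shift :: "(int, 'a, 'm) graded_module \<Rightarrow> int \<Rightarrow> (int, 'a, 'm) graded_module" where
  "shift M n = M\<lparr>grade := \<lambda>i. grade M (i + n)\<rparr>"

definition restrict_scalars_along ::
    "('a \<Rightarrow> 'a) \<Rightarrow> (int, 'a, 'm) graded_module \<Rightarrow> (int, 'a, 'm) graded_module" where
  "restrict_scalars_along \<sigma> M = M\<lparr>smult := \<lambda>a x. \<sigma> a \<odot>\<^bsub>M\<^esub> x\<rparr>"

definition tw :: "'k ring \<Rightarrow> (nat, 'k, 'a) graded_module \<Rightarrow> 'a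
    \<Rightarrow> (int, 'a, 'm) graded_module \<Rightarrow> (int, 'a, 'm) graded_module" where
  "tw K A f M =
     shift (restrict_scalars_along (normalizing_automorphism K A f) M) (- int (deg_of A f))"

definition left_mult :: "'a \<Rightarrow> (int, 'a, 'm) graded_module \<Rightarrow> 'm \<Rightarrow> 'm" where
  "left_mult f M = (\<lambda>x \<in> carrier M. f \<odot>\<^bsub>M\<^esub> x)"


section \<open>Twisted matrix factorizations\<close>

record ('a, 'm) factorization =
  src :: "(int, 'a, 'm) graded_module"
  tgt :: "(int, 'a, 'm) graded_module"
  phi :: "'m \<Rightarrow> 'm"
  tau :: "'m \<Rightarrow> 'm"

text \<open>Since \<^const>\<open>tw\<close> does not change underlying groups, \<open>\<phi>\<^sup>t\<^sup>w\<close> is the function \<open>\<phi>\<close> itself.\<close>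

definition twisted_matrix_factorization :: "'k ring \<Rightarrow> (nat, 'k, 'a) graded_module \<Rightarrow> 'a
    \<Rightarrow> ('a, 'm) factorization \<Rightarrow> bool" where
  "twisted_matrix_factorization K A f U \<longleftrightarrow>
     fg_graded_free A (src U) \<and> fg_graded_free A (tgt U) \<and>
     phi U \<in> graded_hom A (src U) (tgt U) \<and>
     tau U \<in> graded_hom A (tw K A f (tgt U)) (src U) \<and>
     compose (carrier (tgt U)) (phi U) (tau U) = left_mult f (tgt U) \<and>
     compose (carrier (src U)) (tau U) (phi U) = left_mult f (src U)"

text \<open>A morphism is a pair \<open>(\<Psi>\<^sub>G, \<Psi>\<^sub>F)\<close>.  All modules have elements in the (arbitrary) type \<open>'m\<close>.\<close>

definition TMF :: "'k ring \<Rightarrow> (nat, 'k, 'a) graded_module \<Rightarrow> 'a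
    \<Rightarrow> (('a, 'm) factorization, ('m \<Rightarrow> 'm) \<times> ('m \<Rightarrow> 'm)) cat" where
  "TMF K A f = \<lparr>
     Obj = {U. twisted_matrix_factorization K A f U},
     Hom = (\<lambda>U V. {(\<Psi>G, \<Psi>F). \<Psi>G \<in> graded_hom A (tgt U) (tgt V) \<and>
       \<Psi>F \<in> graded_hom A (src U) (src V) \<and>
       compose (carrier (src U)) \<Psi>G (phi U) = compose (carrier (src U)) (phi V) \<Psi>F}),
     Id = (\<lambda>U. (\<lambda>x \<in> carrier (tgt U). x, \<lambda>x \<in> carrier (src U). x)),
     Comp = (\<lambda>U V W (\<Psi>G', \<Psi>F') (\<Psi>G, \<Psi>F).
       (compose (carrier (tgt U)) \<Psi>G' \<Psi>G, compose (carrier (src U)) \<Psi>F' \<Psi>F))\<rparr>"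

end

theory Submission
  imports Defs
begin

text \<open>Let \<open>d\<close> be the degree of \<open>f\<close> and write \<open>B\<close> for the Zhang twist of \<open>A\<close>.  Keep the
  underlying groups and maps of a factorization over \<open>A\<close>, and let \<open>a\<close> act on an element \<open>x\<close> of
  degree \<open>j\<close> of a module as \<open>\<sigma>\<^sup>j a\<close> did.  This gives graded \<open>B\<close>-modules, with the same
  homogeneous bases.  Since \<open>\<sigma> f = f\<close>, left multiplication by \<open>f\<close> is unchanged, and the
  normalizing automorphism of \<open>f\<close> in \<open>B\<close> is \<open>\<sigma>\<^sup>d\<^sup>+\<^sup>1\<close>; hence twisting modules along
  \<open>\<sigma>\<close> commutes with the operation \<^const>\<open>tw\<close>.  As \<open>A\<close> is in turn the twist of \<open>B\<close> by the
  powers of the inverse of \<open>\<sigma>\<close>, the construction can be undone.\<close>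

section \<open>Components in graded groups\<close>

text \<open>All three notions read only the additive monoid and the grading of the record. They
  therefore pass to the twists below, which replace only a product or a scalar
  multiplication.\<close>

lemma same_additive_group:
  fixes M N :: "('i, 'r, 'm) graded_module"
  assumes "carrier N = carrier M" "add N = add M" "\<zero>\<^bsub>N\<^esub> = \<zero>\<^bsub>M\<^esub>" "grade N = grade M"
  shows "finsum N = (finsum M :: ('b \<Rightarrow> 'm) \<Rightarrow> 'b set \<Rightarrow> 'm)"
    and "direct_sum_of_grades N \<longleftrightarrow> direct_sum_of_grades M"
    and "abelian_group N \<longleftrightarrow> abelian_group M"
proof -
  have am: "add_monoid N = add_monoid M"
    using assms by simp
  show "finsum N = (finsum M :: ('b \<Rightarrow> 'm) \<Rightarrow> 'b set \<Rightarrow> 'm)"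
    unfolding finsum_def am ..
  have dec: "is_decomposition N = is_decomposition M"
    by (intro ext) (simp add: is_decomposition_def assms finsum_def am)
  show "direct_sum_of_grades N \<longleftrightarrow> direct_sum_of_grades M"
    by (simp only: direct_sum_of_grades_def dec additive_subgroup_def am assms)
  show "abelian_group N \<longleftrightarrow> abelian_group M"
    by (simp only: abelian_group_def abelian_monoid_def abelian_group_axioms_def am)
qed

text \<open>Common ground for the algebra, graded by \<open>nat\<close>, and its modules, graded by
  \<open>int\<close>; the index type carries no structure here.\<close>

locale graded_group = abelian_group M
  for M :: "('i, 'r, 'm) graded_module" (structure) +
  assumes direct_sum: "direct_sum_of_grades M"
begin

lemma grade_subgroup: "additive_subgroup (grade M i) M"
  using direct_sum by (simp add: direct_sum_of_grades_def)

lemma grade_closed: "x \<in> grade M i \<Longrightarrow> x \<in> carrier M"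
  using additive_subgroup.a_subset[OF grade_subgroup] by blast

lemma grade_zero: "\<zero> \<in> grade M i"
  by (rule additive_subgroup.zero_closed[OF grade_subgroup])

lemma grade_add: "\<lbrakk>x \<in> grade M i; y \<in> grade M i\<rbrakk> \<Longrightarrow> x \<oplus> y \<in> grade M i"
  by (rule additive_subgroup.a_closed[OF grade_subgroup])

lemma is_decomposition_component:
  assumes "x \<in> carrier M"
  shows "is_decomposition M x (component M x)"
proof -
  have "\<exists>!c. is_decomposition M x c"
    using assms direct_sum by (simp add: direct_sum_of_grades_def)
  then show ?thesis
    unfolding component_def by (rule theI')
qed

lemma component_grade: "x \<in> carrier M \<Longrightarrow> component M x i \<in> grade M i"
  using is_decomposition_component by (auto simp: is_decomposition_def)

lemma component_closed: "x \<in> carrier M \<Longrightarrow> component M x i \<in> carrier M"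
  using component_grade grade_closed by blast

lemma finite_support: "x \<in> carrier M \<Longrightarrow> finite {i. component M x i \<noteq> \<zero>}"
  using is_decomposition_component by (auto simp: is_decomposition_def)

lemma sum_components:
  "x \<in> carrier M \<Longrightarrow> x = (\<Oplus>i\<in>{i. component M x i \<noteq> \<zero>}. component M x i)"
  using is_decomposition_component by (auto simp: is_decomposition_def)

lemma sum_components_superset:
  assumes "x \<in> carrier M" "finite S" "{i. component M x i \<noteq> \<zero>} \<subseteq> S"
  shows "x = (\<Oplus>i\<in>S. component M x i)"
proof -
  have "(\<Oplus>i\<in>{i. component M x i \<noteq> \<zero>}. component M x i) = (\<Oplus>i\<in>S. component M x i)"
    by (rule add.finprod_mono_neutral_cong_left) (use assms component_closed in auto)
  then show ?thesis
    using sum_components[OF assms(1)] by simp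
qed

text \<open>Uniqueness of decompositions in usable form: \<open>S\<close> may be larger than the
  support, so a candidate family can be given without computing where it vanishes.\<close>

lemma component_eqI:
  assumes c: "\<And>i. c i \<in> grade M i" and S: "finite S" "\<And>i. i \<notin> S \<Longrightarrow> c i = \<zero>"
    and x: "x = (\<Oplus>i\<in>S. c i)"
  shows "component M x = c"
proof -
  have cc: "c \<in> S \<rightarrow> carrier M"
    using c grade_closed by blast
  have "x \<in> carrier M"
    unfolding x by (rule finsum_closed[OF cc])
  moreover have "is_decomposition M x c"
  proof -
    have fin: "finite {i. c i \<noteq> \<zero>}"
      by (rule finite_subset[OF _ S(1)]) (use S(2) in auto)
    have "(\<Oplus>i\<in>{i. c i \<noteq> \<zero>}. c i) = (\<Oplus>i\<in>S. c i)"
      by (rule add.finprod_mono_neutral_cong_left) (use S cc in auto)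
    with fin c x show ?thesis
      by (simp add: is_decomposition_def)
  qed
  ultimately show ?thesis
    using is_decomposition_component direct_sum unfolding direct_sum_of_grades_def by blast
qed

lemma component_add:
  assumes x: "x \<in> carrier M" and y: "y \<in> carrier M"
  shows "component M (x \<oplus> y) = (\<lambda>i. component M x i \<oplus> component M y i)"
proof (rule component_eqI)
  let ?S = "{i. component M x i \<noteq> \<zero>} \<union> {i. component M y i \<noteq> \<zero>}"
  show fin: "finite ?S"
    using x y finite_support by blast
  show "component M x i \<oplus> component M y i \<in> grade M i" for i
    using x y component_grade grade_add by blast
  show "component M x i \<oplus> component M y i = \<zero>" if "i \<notin> ?S" for i
    using that by simp
  have "x \<oplus> y = (\<Oplus>i\<in>?S. component M x i) \<oplus> (\<Oplus>i\<in>?S. component M y i)"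
    using sum_components_superset[OF x fin] sum_components_superset[OF y fin] by simp
  also have "\<dots> = (\<Oplus>i\<in>?S. component M x i \<oplus> component M y i)"
    by (rule finsum_addf[symmetric]) (use x y component_closed in auto)
  finally show "x \<oplus> y = (\<Oplus>i\<in>?S. component M x i \<oplus> component M y i)" .
qed

lemma component_homogeneous:
  assumes "x \<in> grade M j"
  shows "component M x = (\<lambda>i. if i = j then x else \<zero>)"
  by (rule component_eqI[where S = "{j}"])
    (use assms grade_zero grade_closed in \<open>auto simp: finsum_insert finsum_empty\<close>)

lemma grade_disjoint:
  assumes "x \<in> grade M i" "x \<in> grade M j" "x \<noteq> \<zero>"
  shows "i = j"
  using component_homogeneous[OF assms(1)] component_homogeneous[OF assms(2)] assms(3)
  by (metis (full_types))

text \<open>Every element is the finite sum of its components. The empty sum falls under the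
  homogeneous case, because \<open>\<zero>\<close> lies in every grade.\<close>

lemma homogeneous_induct [consumes 1, case_names homogeneous add]:
  assumes "x \<in> carrier M"
    and hom: "\<And>i y. y \<in> grade M i \<Longrightarrow> P y"
    and add: "\<And>y z. \<lbrakk>y \<in> carrier M; z \<in> carrier M; P y; P z\<rbrakk> \<Longrightarrow> P (y \<oplus> z)"
  shows "P x"
proof -
  have "P (\<Oplus>i\<in>S. component M x i)" if "finite S" for S
    using that
  proof (induction S)
    case empty
    show ?case using hom[OF grade_zero] by (simp add: finsum_empty)
  next
    case (insert i S)
    have "(\<Oplus>i\<in>insert i S. component M x i) = component M x i \<oplus> (\<Oplus>i\<in>S. component M x i)"
      by (rule finsum_insert) (use insert component_closed assms(1) in auto)
    moreover have "P (component M x i)"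
      using hom component_grade assms(1) by blast
    moreover have "(\<Oplus>i\<in>S. component M x i) \<in> carrier M"
      by (rule finsum_closed) (use component_closed assms(1) in auto)
    ultimately show ?case
      using add insert.IH component_closed[OF assms(1)] by simp
  qed
  from this[OF finite_support[OF assms(1)]] show ?thesis
    using sum_components[OF assms(1)] by simp
qed

text \<open>Additive maps given on each grade glue to one additive map on the whole group. The Zhang
  product in its right factor and the twisted scalar multiplication are both of this form.\<close>

lemma component_sum_extension:
  fixes N :: "('n, 'c) ring_scheme" and h :: "'i \<Rightarrow> 'm \<Rightarrow> 'n"
  assumes N: "abelian_group N"
    and closed: "\<And>i x. x \<in> grade M i \<Longrightarrow> h i x \<in> carrier N"
    and additive: "\<And>i x y. \<lbrakk>x \<in> grade M i; y \<in> grade M i\<rbrakk> \<Longrightarrow> h i (x \<oplus> y) = h i x \<oplus>\<^bsub>N\<^esub> h i y"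
  defines "H \<equiv> \<lambda>x. \<Oplus>\<^bsub>N\<^esub>i\<in>{i. component M x i \<noteq> \<zero>}. h i (component M x i)"
  shows "x \<in> carrier M \<Longrightarrow> H x \<in> carrier N"
    and "x \<in> grade M j \<Longrightarrow> H x = h j x"
    and "\<lbrakk>x \<in> carrier M; y \<in> carrier M\<rbrakk> \<Longrightarrow> H (x \<oplus> y) = H x \<oplus>\<^bsub>N\<^esub> H y"
proof -
  interpret N: abelian_group N by fact
  have cl: "h i (component M x i) \<in> carrier N" if "x \<in> carrier M" for i x
    using closed component_grade that by blast
  \<comment> \<open>Indices outside the support must contribute nothing; this allows the sums for
    \<open>x\<close>, \<open>y\<close> and their sum to be taken over one common index set.\<close>
  have h0: "h i \<zero> = \<zero>\<^bsub>N\<^esub>" for i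
  proof -
    have "h i \<zero> \<oplus>\<^bsub>N\<^esub> h i \<zero> = h i \<zero>"
      using additive[OF grade_zero grade_zero, of i] by simp
    then show ?thesis
      using closed[OF grade_zero, of i] by (simp add: N.add.l_cancel_one)
  qed
  have H_superset: "H x = (\<Oplus>\<^bsub>N\<^esub>i\<in>S. h i (component M x i))"
    if "x \<in> carrier M" "finite S" "{i. component M x i \<noteq> \<zero>} \<subseteq> S" for x S
    unfolding H_def
    by (rule N.add.finprod_mono_neutral_cong_left) (use that cl h0 in auto)
  show "x \<in> carrier M \<Longrightarrow> H x \<in> carrier N"
    unfolding H_def by (rule N.finsum_closed) (use cl in auto)
  show "H x = h j x" if x: "x \<in> grade M j"
  proof -
    have "H x = (\<Oplus>\<^bsub>N\<^esub>i\<in>{j}. h i (component M x i))"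
      by (rule H_superset) (use x in \<open>auto simp: grade_closed component_homogeneous[OF x] split: if_splits\<close>)
    also have "\<dots> = h j x"
      using closed[OF x] by (simp add: component_homogeneous[OF x] N.finsum_insert N.finsum_empty)
    finally show ?thesis .
  qed
  show "H (x \<oplus> y) = H x \<oplus>\<^bsub>N\<^esub> H y" if x: "x \<in> carrier M" and y: "y \<in> carrier M"
  proof -
    let ?S = "{i. component M x i \<noteq> \<zero>} \<union> {i. component M y i \<noteq> \<zero>}"
    have fin: "finite ?S"
      using x y finite_support by blast
    have "H (x \<oplus> y) = (\<Oplus>\<^bsub>N\<^esub>i\<in>?S. h i (component M (x \<oplus> y) i))"
      by (rule H_superset) (use x y fin in \<open>auto simp: component_add\<close>)
    also have "\<dots> = (\<Oplus>\<^bsub>N\<^esub>i\<in>?S. h i (component M x i) \<oplus>\<^bsub>N\<^esub> h i (component M y i))"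
      by (rule N.finsum_cong')
        (use cl x y component_grade additive in \<open>auto simp: component_add\<close>)
    also have "\<dots> = (\<Oplus>\<^bsub>N\<^esub>i\<in>?S. h i (component M x i)) \<oplus>\<^bsub>N\<^esub> (\<Oplus>\<^bsub>N\<^esub>i\<in>?S. h i (component M y i))"
      by (rule N.finsum_addf) (use cl x y in auto)
    also have "\<dots> = H x \<oplus>\<^bsub>N\<^esub> H y"
      using H_superset[OF x fin] H_superset[OF y fin] by simp
    finally show ?thesis .
  qed
qed

end

lemma (in graded_left_module) graded_group: "graded_group M"
  by (intro graded_group.intro graded_group_axioms.intro M.abelian_group_axioms direct_sum)

lemma (in connected_graded_algebra) graded_group: "graded_group A"
  by (intro graded_group.intro graded_group_axioms.intro A.abelian_group_axioms direct_sum)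

section \<open>The category of factorizations\<close>

lemma graded_homD:
  assumes "\<phi> \<in> graded_hom A M N"
  shows "x \<in> carrier M \<Longrightarrow> \<phi> x \<in> carrier N"
    and "\<phi> \<in> extensional (carrier M)"
    and "\<lbrakk>x \<in> carrier M; y \<in> carrier M\<rbrakk> \<Longrightarrow> \<phi> (x \<oplus>\<^bsub>M\<^esub> y) = \<phi> x \<oplus>\<^bsub>N\<^esub> \<phi> y"
    and "\<lbrakk>a \<in> carrier A; x \<in> carrier M\<rbrakk> \<Longrightarrow> \<phi> (a \<odot>\<^bsub>M\<^esub> x) = a \<odot>\<^bsub>N\<^esub> \<phi> x"
    and "x \<in> grade M i \<Longrightarrow> \<phi> x \<in> grade N i"
  using assms by (auto simp: graded_hom_def PiE_iff image_subset_iff)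

lemma graded_hom_compose:
  assumes L: "graded_left_module A L"
    and g: "g \<in> graded_hom A L M" and h: "h \<in> graded_hom A M N"
  shows "compose (carrier L) h g \<in> graded_hom A L N"
proof -
  interpret L: graded_left_module A L by fact
  interpret gr: graded_group L by (rule L.graded_group)
  show ?thesis
    using graded_homD[OF g] graded_homD[OF h]
    unfolding graded_hom_def by (auto simp: compose_def gr.grade_closed L.smult_closed)
qed

text \<open>The record fields \<^const>\<open>mult\<close> and \<^const>\<open>one\<close>, and the scalar multiplication outside the
  carriers, are meaningless for a module; hence equality of modules is too strict a notion.\<close>

definition same_module :: "('a, 'b) ring_scheme \<Rightarrow> (int, 'a, 'm) graded_module
    \<Rightarrow> (int, 'a, 'm) graded_module \<Rightarrow> bool" where
  "same_module A M N \<longleftrightarrow> carrier N = carrier M \<and> add N = add M \<and> grade N = grade M \<and>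
     (\<forall>a \<in> carrier A. \<forall>x \<in> carrier M. a \<odot>\<^bsub>N\<^esub> x = a \<odot>\<^bsub>M\<^esub> x)"

text \<open>Supplies both an isomorphism and its inverse when a module is compared with its double
  twist.\<close>

lemma identity_graded_hom:
  assumes M: "graded_left_module A M" and same: "same_module A M N"
  shows "(\<lambda>x \<in> carrier M. x) \<in> graded_hom A M N" "(\<lambda>x \<in> carrier M. x) \<in> graded_hom A N M"
proof -
  interpret M: graded_left_module A M by fact
  interpret gr: graded_group M by (rule M.graded_group)
  show "(\<lambda>x \<in> carrier M. x) \<in> graded_hom A M N" "(\<lambda>x \<in> carrier M. x) \<in> graded_hom A N M"
    using same by (auto simp: graded_hom_def same_module_def M.smult_closed gr.grade_closed)
qed

lemma compose_identity:
  assumes "\<phi> \<in> S \<rightarrow>\<^sub>E T"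
  shows "compose S \<phi> (\<lambda>x \<in> S. x) = \<phi>" and "compose S (\<lambda>x \<in> T. x) \<phi> = \<phi>"
  using assms by (auto simp: compose_def fun_eq_iff PiE_iff extensional_def)

lemma category_TMF: "category (TMF K A f)"
proof
  show "Id (TMF K A f) U \<in> Hom (TMF K A f) U U" if "U \<in> Obj (TMF K A f)" for U
  proof -
    from that have src: "graded_left_module A (src U)" and tgt: "graded_left_module A (tgt U)"
      and phi: "phi U \<in> graded_hom A (src U) (tgt U)"
      by (auto simp: TMF_def twisted_matrix_factorization_def fg_graded_free_def)
    have "(\<lambda>x \<in> carrier M. x) \<in> graded_hom A M M" if "graded_left_module A M" for M
      using identity_graded_hom(1)[OF that] by (simp add: same_module_def)
    with src tgt show ?thesis
      using graded_homD[OF phi] by (auto simp: TMF_def compose_def restrict_def)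
  qed
next
  fix U V W g h
  assume U: "U \<in> Obj (TMF K A f)" and V: "V \<in> Obj (TMF K A f)" and W: "W \<in> Obj (TMF K A f)"
    and g: "g \<in> Hom (TMF K A f) U V" and h: "h \<in> Hom (TMF K A f) V W"
  obtain gG gF where g': "g = (gG, gF)" "gG \<in> graded_hom A (tgt U) (tgt V)"
    "gF \<in> graded_hom A (src U) (src V)"
    "compose (carrier (src U)) gG (phi U) = compose (carrier (src U)) (phi V) gF"
    using g by (auto simp: TMF_def)
  obtain hG hF where h': "h = (hG, hF)" "hG \<in> graded_hom A (tgt V) (tgt W)"
    "hF \<in> graded_hom A (src V) (src W)"
    "compose (carrier (src V)) hG (phi V) = compose (carrier (src V)) (phi W) hF"
    using h by (auto simp: TMF_def)
  have mods: "graded_left_module A (src U)" "graded_left_module A (tgt U)"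
    and phi: "phi U \<in> graded_hom A (src U) (tgt U)"
    using U by (auto simp: TMF_def twisted_matrix_factorization_def fg_graded_free_def)
  \<comment> \<open>The two commuting squares are pasted along \<open>phi V\<close>; off the carrier
    both composites are \<open>undefined\<close>.\<close>
  have square: "compose (carrier (src U)) (compose (carrier (tgt U)) hG gG) (phi U) =
    compose (carrier (src U)) (phi W) (compose (carrier (src U)) hF gF)" (is "?l = ?r")
  proof
    fix x
    show "?l x = ?r x"
    proof (cases "x \<in> carrier (src U)")
      case True
      then have "gG (phi U x) = phi V (gF x)" "hG (phi V (gF x)) = phi W (hF (gF x))"
        using fun_cong[OF g'(4), of x] fun_cong[OF h'(4), of "gF x"] graded_homD(1)[OF g'(3)]
        by (auto simp: compose_eq)
      then show ?thesis
        using True graded_homD(1)[OF phi] by (simp add: compose_eq)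
    qed (simp add: compose_def)
  qed
  show "Comp (TMF K A f) U V W h g \<in> Hom (TMF K A f) U W"
    using square mods graded_hom_compose g' h' by (auto simp: TMF_def)
next
  fix U V g
  assume "g \<in> Hom (TMF K A f) U V"
  then obtain gG gF where g: "g = (gG, gF)" "gG \<in> graded_hom A (tgt U) (tgt V)"
    "gF \<in> graded_hom A (src U) (src V)"
    by (auto simp: TMF_def)
  show "Comp (TMF K A f) U U V g (Id (TMF K A f) U) = g"
    "Comp (TMF K A f) U V V (Id (TMF K A f) V) g = g"
    using compose_identity[of gG "carrier (tgt U)" "carrier (tgt V)"]
      compose_identity[of gF "carrier (src U)" "carrier (src V)"] g(2,3)
    by (simp_all add: TMF_def g(1) graded_hom_def)
next
  fix T U V W g h k
  assume "g \<in> Hom (TMF K A f) T U" "h \<in> Hom (TMF K A f) U V" "k \<in> Hom (TMF K A f) V W"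
  then show "Comp (TMF K A f) T V W k (Comp (TMF K A f) T U V h g) =
    Comp (TMF K A f) T U W (Comp (TMF K A f) U V W k h) g"
    by (auto simp: TMF_def compose_def fun_eq_iff graded_homD(1))
qed


section \<open>Twisting modules\<close>

text \<open>Zhang's twist of a module. The family \<open>\<rho>\<close> is indexed by
  \<open>int\<close> because module degrees may be negative.\<close>

definition twist_module ::
    "(int \<Rightarrow> 'a \<Rightarrow> 'a) \<Rightarrow> (int, 'a, 'm) graded_module \<Rightarrow> (int, 'a, 'm) graded_module" where
  "twist_module \<rho> M = M\<lparr>smult := \<lambda>a x.
     \<Oplus>\<^bsub>M\<^esub>i\<in>{i. component M x i \<noteq> \<zero>\<^bsub>M\<^esub>}. \<rho> i a \<odot>\<^bsub>M\<^esub> component M x i\<rparr>"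

lemma twist_module_simps [simp]:
  "carrier (twist_module \<rho> M) = carrier M" "add (twist_module \<rho> M) = add M"
  "\<zero>\<^bsub>twist_module \<rho> M\<^esub> = \<zero>\<^bsub>M\<^esub>" "grade (twist_module \<rho> M) = grade M"
  by (simp_all add: twist_module_def)

text \<open>An action of the additive group of integers by graded ring automorphisms, with laws on
  the carrier only. By \<open>\<rho>_zero\<close> and \<open>\<rho>_comp\<close>,
  \<open>\<rho> (- n)\<close> inverts \<open>\<rho> n\<close> there.\<close>

locale graded_automorphism_action = A: ring A
  for A :: "(nat, 'k, 'a) graded_module" +
  fixes \<rho> :: "int \<Rightarrow> 'a \<Rightarrow> 'a"
  assumes direct_sum: "direct_sum_of_grades A"
    and \<rho>_closed: "a \<in> carrier A \<Longrightarrow> \<rho> n a \<in> carrier A"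
    and \<rho>_add: "\<lbrakk>a \<in> carrier A; b \<in> carrier A\<rbrakk> \<Longrightarrow> \<rho> n (a \<oplus>\<^bsub>A\<^esub> b) = \<rho> n a \<oplus>\<^bsub>A\<^esub> \<rho> n b"
    and \<rho>_mult: "\<lbrakk>a \<in> carrier A; b \<in> carrier A\<rbrakk> \<Longrightarrow> \<rho> n (a \<otimes>\<^bsub>A\<^esub> b) = \<rho> n a \<otimes>\<^bsub>A\<^esub> \<rho> n b"
    and \<rho>_one: "\<rho> n \<one>\<^bsub>A\<^esub> = \<one>\<^bsub>A\<^esub>"
    and \<rho>_grade: "a \<in> grade A i \<Longrightarrow> \<rho> n a \<in> grade A i"
    and \<rho>_zero: "a \<in> carrier A \<Longrightarrow> \<rho> 0 a = a"
    and \<rho>_comp: "a \<in> carrier A \<Longrightarrow> \<rho> m (\<rho> n a) = \<rho> (m + n) a"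

sublocale graded_automorphism_action \<subseteq> grA: graded_group A
  by (intro graded_group.intro graded_group_axioms.intro A.abelian_group_axioms direct_sum)

text \<open>\<open>B\<close> is characterized by its product instead of being
  \<open>zhang_twist\<close> itself, so that \<open>A\<close> and \<open>B\<close> can change
  places. Everything proved here then also yields the construction in the other direction.\<close>

locale twisted_algebras = graded_automorphism_action A \<rho> + B: ring B
  for A B :: "(nat, 'k, 'a) graded_module" and \<rho> +
  assumes same [simp]: "carrier B = carrier A" "add B = add A" "\<zero>\<^bsub>B\<^esub> = \<zero>\<^bsub>A\<^esub>"
      "\<one>\<^bsub>B\<^esub> = \<one>\<^bsub>A\<^esub>" "grade B = grade A"
    and mult_B: "\<lbrakk>a \<in> carrier A; b \<in> grade A i\<rbrakk> \<Longrightarrow> a \<otimes>\<^bsub>B\<^esub> b = \<rho> (int i) a \<otimes>\<^bsub>A\<^esub> b"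
begin

text \<open>The maps \<open>\<rho> n\<close> and \<open>\<rho> i\<close> commute, and
  \<open>\<rho> n b\<close> has the same degree \<open>i\<close> as \<open>b\<close>; so
  \<open>\<rho> n\<close> passes through the twist in the product of \<open>B\<close>.\<close>

lemma \<rho>_mult_B:
  assumes a: "a \<in> carrier A" and b: "b \<in> carrier A"
  shows "\<rho> n (a \<otimes>\<^bsub>B\<^esub> b) = \<rho> n a \<otimes>\<^bsub>B\<^esub> \<rho> n b"
  using b
proof (induction b rule: grA.homogeneous_induct)
  case (homogeneous i b)
  then show ?case
    using a mult_B[of "\<rho> n a" "\<rho> n b" i]
    by (simp add: mult_B \<rho>_mult \<rho>_comp \<rho>_closed \<rho>_grade grA.grade_closed add.commute)
next
  case (add b c)
  then show ?case
    using a B.r_distr[of b c a] B.r_distr[of "\<rho> n b" "\<rho> n c" "\<rho> n a"] B.m_closed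
    by (simp add: \<rho>_add \<rho>_closed)
qed

text \<open>On a right factor of degree \<open>m\<close>, the twist by \<open>\<rho> m\<close>
  cancels the twist by \<open>\<rho> (- m)\<close>.\<close>

lemma twisted_algebras_sym: "twisted_algebras B A (\<lambda>n. \<rho> (- n))"
proof (intro twisted_algebras.intro twisted_algebras_axioms.intro graded_automorphism_action.intro
    graded_automorphism_action_axioms.intro)
  show "direct_sum_of_grades B"
    using direct_sum by (subst same_additive_group(2)[of B A]) simp_all
  show "a \<otimes>\<^bsub>A\<^esub> b = \<rho> (- int m) a \<otimes>\<^bsub>B\<^esub> b" if "a \<in> carrier B" "b \<in> grade B m" for a b m
    using that by (simp add: mult_B \<rho>_closed \<rho>_comp \<rho>_zero)
qed (simp_all add: A.ring_axioms B.ring_axioms \<rho>_closed \<rho>_add \<rho>_mult_B \<rho>_one \<rho>_grade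
    \<rho>_zero \<rho>_comp add.commute)

text \<open>The instance of \<open>component_sum_extension\<close> whose map on degree
  \<open>i\<close> is the old action of \<open>\<rho> i a\<close>. After this the defining sum is
  never unfolded again.\<close>

lemma twist_module_smult:
  assumes M: "graded_left_module A M" and a: "a \<in> carrier A"
  shows "x \<in> carrier M \<Longrightarrow> a \<odot>\<^bsub>twist_module \<rho> M\<^esub> x \<in> carrier M"
    and "x \<in> grade M j \<Longrightarrow> a \<odot>\<^bsub>twist_module \<rho> M\<^esub> x = \<rho> j a \<odot>\<^bsub>M\<^esub> x"
    and "\<lbrakk>x \<in> carrier M; y \<in> carrier M\<rbrakk> \<Longrightarrow> a \<odot>\<^bsub>twist_module \<rho> M\<^esub> (x \<oplus>\<^bsub>M\<^esub> y) =
      a \<odot>\<^bsub>twist_module \<rho> M\<^esub> x \<oplus>\<^bsub>M\<^esub> a \<odot>\<^bsub>twist_module \<rho> M\<^esub> y"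
proof -
  interpret M: graded_left_module A M by fact
  interpret gr: graded_group M by (rule M.graded_group)
  have closed: "\<rho> i a \<odot>\<^bsub>M\<^esub> x \<in> carrier M" if "x \<in> grade M i" for i x
    using that a by (simp add: M.smult_closed \<rho>_closed gr.grade_closed)
  have additive: "\<rho> i a \<odot>\<^bsub>M\<^esub> (x \<oplus>\<^bsub>M\<^esub> y) = \<rho> i a \<odot>\<^bsub>M\<^esub> x \<oplus>\<^bsub>M\<^esub> \<rho> i a \<odot>\<^bsub>M\<^esub> y"
    if "x \<in> grade M i" "y \<in> grade M i" for i x y
    using that a by (simp add: M.smult_r_distr \<rho>_closed gr.grade_closed)
  note ext = gr.component_sum_extension[OF M.M.abelian_group_axioms,
      where h = "\<lambda>i. smult M (\<rho> i a)", OF closed additive]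
  show "x \<in> carrier M \<Longrightarrow> a \<odot>\<^bsub>twist_module \<rho> M\<^esub> x \<in> carrier M"
    and "x \<in> grade M j \<Longrightarrow> a \<odot>\<^bsub>twist_module \<rho> M\<^esub> x = \<rho> j a \<odot>\<^bsub>M\<^esub> x"
    and "\<lbrakk>x \<in> carrier M; y \<in> carrier M\<rbrakk> \<Longrightarrow> a \<odot>\<^bsub>twist_module \<rho> M\<^esub> (x \<oplus>\<^bsub>M\<^esub> y) =
      a \<odot>\<^bsub>twist_module \<rho> M\<^esub> x \<oplus>\<^bsub>M\<^esub> a \<odot>\<^bsub>twist_module \<rho> M\<^esub> y"
    using ext by (simp_all add: twist_module_def)
qed

text \<open>Only associativity has content. For \<open>b\<close> of degree \<open>i\<close> and
  \<open>x\<close> of degree \<open>j\<close>, the element \<open>b x\<close> has degree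
  \<open>i + j\<close>, where \<open>a\<close> acts as \<open>\<rho> (i + j) a\<close>; this is
  \<open>\<rho> j\<close> of the factor \<open>\<rho> i a\<close> that occurs in the product of
  \<open>B\<close>.\<close>

lemma graded_left_module_twist:
  assumes M: "graded_left_module A M"
  shows "graded_left_module B (twist_module \<rho> M)" (is "graded_left_module B ?T")
proof -
  interpret M: graded_left_module A M by fact
  interpret gr: graded_group M by (rule M.graded_group)
  note smult = twist_module_smult[OF M]
  have group: "abelian_group ?T"
    using M.M.abelian_group_axioms by (subst same_additive_group(3)[of ?T M]) simp_all
  have l_distr: "(a \<oplus>\<^bsub>A\<^esub> b) \<odot>\<^bsub>?T\<^esub> x = a \<odot>\<^bsub>?T\<^esub> x \<oplus>\<^bsub>M\<^esub> b \<odot>\<^bsub>?T\<^esub> x"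
    if ab: "a \<in> carrier A" "b \<in> carrier A" and x: "x \<in> carrier M" for a b x
    using x
  proof (induction x rule: gr.homogeneous_induct)
    case (homogeneous i x)
    with ab show ?case
      by (simp add: smult(2) \<rho>_add \<rho>_closed M.smult_l_distr gr.grade_closed)
  next
    case (add x y)
    with ab show ?case
      by (simp add: smult(1,3) M.M.a_ac)
  qed
  \<comment> \<open>The scalar \<open>b\<close> is decomposed first, with \<open>x\<close> of fixed
    degree; additivity in \<open>x\<close> removes that restriction afterwards.\<close>
  have assoc_homogeneous: "(a \<otimes>\<^bsub>B\<^esub> b) \<odot>\<^bsub>?T\<^esub> x = a \<odot>\<^bsub>?T\<^esub> (b \<odot>\<^bsub>?T\<^esub> x)"
    if ab: "a \<in> carrier A" "b \<in> carrier A" and x: "x \<in> grade M j" for a b x j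
    using ab(2)
  proof (induction b rule: grA.homogeneous_induct)
    case (homogeneous i b)
    have b: "b \<in> carrier A" and xc: "x \<in> carrier M"
      using homogeneous x grA.grade_closed gr.grade_closed by auto
    have "\<rho> j b \<odot>\<^bsub>M\<^esub> x \<in> grade M (int i + j)"
      using homogeneous x by (simp add: M.grade_smult \<rho>_grade)
    with homogeneous x ab(1) b xc show ?case
      by (simp add: smult(2) mult_B \<rho>_mult \<rho>_comp \<rho>_closed M.smult_assoc add.commute)
  next
    case (add b c)
    have xc: "x \<in> carrier M"
      using x gr.grade_closed by auto
    have "(a \<otimes>\<^bsub>B\<^esub> (b \<oplus>\<^bsub>A\<^esub> c)) \<odot>\<^bsub>?T\<^esub> x = (a \<otimes>\<^bsub>B\<^esub> b \<oplus>\<^bsub>A\<^esub> a \<otimes>\<^bsub>B\<^esub> c) \<odot>\<^bsub>?T\<^esub> x"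
      using B.r_distr[of b c a] add ab(1) by simp
    also have "\<dots> = (a \<otimes>\<^bsub>B\<^esub> b) \<odot>\<^bsub>?T\<^esub> x \<oplus>\<^bsub>M\<^esub> (a \<otimes>\<^bsub>B\<^esub> c) \<odot>\<^bsub>?T\<^esub> x"
      using B.m_closed add ab(1) xc by (simp add: l_distr)
    finally show ?case
      using add ab(1) xc by (simp add: l_distr smult(1,3))
  qed
  show ?thesis
  proof (intro graded_left_module.intro graded_left_module_axioms.intro)
    show "ring B" by (rule B.ring_axioms)
    show "abelian_group ?T" by (rule group)
    show "direct_sum_of_grades ?T"
      using M.direct_sum by (subst same_additive_group(2)[of ?T M]) simp_all
    show "(a \<otimes>\<^bsub>B\<^esub> b) \<odot>\<^bsub>?T\<^esub> x = a \<odot>\<^bsub>?T\<^esub> (b \<odot>\<^bsub>?T\<^esub> x)"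
      if ab: "a \<in> carrier B" "b \<in> carrier B" and x: "x \<in> carrier ?T" for a b x
    proof -
      have "x \<in> carrier M" using x by simp
      then show ?thesis
      proof (induction x rule: gr.homogeneous_induct)
        case (homogeneous i x)
        with ab show ?case by (simp add: assoc_homogeneous)
      next
        case (add x y)
        with ab B.m_closed show ?case by (simp add: smult(1,3))
      qed
    qed
    show "\<one>\<^bsub>B\<^esub> \<odot>\<^bsub>?T\<^esub> x = x" if "x \<in> carrier ?T" for x
    proof -
      have "x \<in> carrier M" using that by simp
      then show ?thesis
      proof (induction x rule: gr.homogeneous_induct)
        case (homogeneous i x)
        then show ?case by (simp add: smult(2) \<rho>_one M.smult_one gr.grade_closed)
      next
        case (add x y)
        then show ?case by (simp add: smult(3))
      qed
    qed
    show "a \<odot>\<^bsub>?T\<^esub> x \<in> grade ?T (int i + j)" if "a \<in> grade B i" "x \<in> grade ?T j" for a x i j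
      using that by (simp add: smult(2) grA.grade_closed M.grade_smult \<rho>_grade)
  qed (simp_all add: smult l_distr)
qed

text \<open>The same homogeneous basis works: at a basis element of degree \<open>j\<close>,
  twisting changes the coefficient by the bijection \<open>\<rho> j\<close>.\<close>

lemma fg_graded_free_twist:
  assumes "fg_graded_free A M"
  shows "fg_graded_free B (twist_module \<rho> M)"
proof -
  have M: "graded_left_module A M"
    using assms by (simp add: fg_graded_free_def)
  interpret M: graded_left_module A M by fact
  interpret gr: graded_group M by (rule M.graded_group)
  obtain S where S: "finite S" "S \<subseteq> (\<Union>i. grade M i)"
    and basis: "\<forall>x \<in> carrier M.
      \<exists>!c. c \<in> S \<rightarrow>\<^sub>E carrier A \<and> x = (\<Oplus>\<^bsub>M\<^esub>b\<in>S. c b \<odot>\<^bsub>M\<^esub> b)"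
    using assms unfolding fg_graded_free_def by blast
  \<comment> \<open>A degree is chosen for each basis element, since membership in a grade alone
    does not name one.\<close>
  obtain g where g: "b \<in> grade M (g b)" if "b \<in> S" for b
    using S(2) by (metis UN_iff subsetD)
  then have S_carrier: "b \<in> carrier M" if "b \<in> S" for b
    using that gr.grade_closed by blast
  have same_sum: "(\<Oplus>\<^bsub>M\<^esub>b\<in>S. c b \<odot>\<^bsub>twist_module \<rho> M\<^esub> b) = (\<Oplus>\<^bsub>M\<^esub>b\<in>S. (\<lambda>b\<in>S. \<rho> (g b) (c b)) b \<odot>\<^bsub>M\<^esub> b)"
    if c: "c \<in> S \<rightarrow>\<^sub>E carrier A" for c
    by (rule M.M.finsum_cong') (use c g in \<open>auto simp: twist_module_smult(2)[OF M] PiE_iff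
        \<rho>_closed M.smult_closed S_carrier\<close>)
  have "\<exists>!c. c \<in> S \<rightarrow>\<^sub>E carrier A \<and> x = (\<Oplus>\<^bsub>M\<^esub>b\<in>S. c b \<odot>\<^bsub>twist_module \<rho> M\<^esub> b)"
    if "x \<in> carrier M" for x
  proof -
    have "\<exists>!c. c \<in> S \<rightarrow>\<^sub>E carrier A \<and> x = (\<Oplus>\<^bsub>M\<^esub>b\<in>S. c b \<odot>\<^bsub>M\<^esub> b)" (is "\<exists>!c. ?basis c")
      using basis \<open>x \<in> carrier M\<close> by blast
    then obtain e where e: "?basis e" and unique: "\<And>c. ?basis c \<Longrightarrow> c = e"
      by blast
    show ?thesis
    proof (rule ex1I)
      \<comment> \<open>The old coefficients \<open>e\<close>, moved back by the inverse
        automorphisms so that the twisted action restores them.\<close>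
      let ?c = "\<lambda>b\<in>S. \<rho> (- g b) (e b)"
      have c: "?c \<in> S \<rightarrow>\<^sub>E carrier A"
        using e by (auto simp: PiE_iff \<rho>_closed)
      have eq: "(\<lambda>b\<in>S. \<rho> (g b) (?c b)) = e"
        using e by (auto simp: fun_eq_iff PiE_iff extensional_def \<rho>_comp \<rho>_zero)
      have "(\<Oplus>\<^bsub>M\<^esub>b\<in>S. ?c b \<odot>\<^bsub>twist_module \<rho> M\<^esub> b) = (\<Oplus>\<^bsub>M\<^esub>b\<in>S. e b \<odot>\<^bsub>M\<^esub> b)"
        using same_sum[OF c] unfolding eq .
      then show "?c \<in> S \<rightarrow>\<^sub>E carrier A \<and> x = (\<Oplus>\<^bsub>M\<^esub>b\<in>S. ?c b \<odot>\<^bsub>twist_module \<rho> M\<^esub> b)"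
        using c e by simp
    next
      fix c
      assume c: "c \<in> S \<rightarrow>\<^sub>E carrier A \<and> x = (\<Oplus>\<^bsub>M\<^esub>b\<in>S. c b \<odot>\<^bsub>twist_module \<rho> M\<^esub> b)"
      then have "(\<lambda>b\<in>S. \<rho> (g b) (c b)) = e"
        by (intro unique) (auto simp: same_sum PiE_iff \<rho>_closed)
      then have eq: "e = (\<lambda>b\<in>S. \<rho> (g b) (c b))"
        by simp
      show "c = (\<lambda>b\<in>S. \<rho> (- g b) (e b))"
        unfolding eq using c by (auto simp: fun_eq_iff PiE_iff extensional_def \<rho>_comp \<rho>_zero)
    qed
  qed
  then show ?thesis
    using S graded_left_module_twist[OF M]
    unfolding fg_graded_free_def
    by (intro conjI exI[of _ S])
      (simp_all add: same_additive_group(1)[of "twist_module \<rho> M" M])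
qed

text \<open>In every degree \<open>f\<close> acts as \<open>\<rho> j f\<close>, which is
  \<open>f\<close>. Hence the two equations of a factorization survive twisting.\<close>

lemma left_mult_twist:
  assumes M: "graded_left_module A M" and f: "f \<in> carrier A" "\<And>n. \<rho> n f = f"
  shows "left_mult f (twist_module \<rho> M) = left_mult f M"
proof -
  interpret M: graded_left_module A M by fact
  interpret gr: graded_group M by (rule M.graded_group)
  have "f \<odot>\<^bsub>twist_module \<rho> M\<^esub> x = f \<odot>\<^bsub>M\<^esub> x" if "x \<in> carrier M" for x
    using that
  proof (induction x rule: gr.homogeneous_induct)
    case (add x y)
    then show ?case using f by (simp add: twist_module_smult(3)[OF M] M.smult_r_distr)
  qed (simp add: twist_module_smult(2)[OF M] f)
  then show ?thesis
    by (auto simp: left_mult_def fun_eq_iff restrict_def)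
qed

end


section \<open>Twisting factorizations\<close>

lemma identity_functor: "category C \<Longrightarrow> cat_functor C C (\<lambda>U. U) (\<lambda>U V g. g)"
  by (simp add: cat_functor_def cat_functor_axioms_def)

lemma cat_functor_compose:
  assumes "cat_functor C D Fo Fm" "cat_functor D E Go Gm"
  shows "cat_functor C E (\<lambda>U. Go (Fo U)) (\<lambda>U V g. Gm (Fo U) (Fo V) (Fm U V g))"
proof -
  interpret F: cat_functor C D Fo Fm by fact
  interpret G: cat_functor D E Go Gm by fact
  show ?thesis
    by unfold_locales
      (simp_all add: F.Fo_in_Obj F.Fm_in_Hom F.Fm_Id F.Fm_Comp G.Fo_in_Obj G.Fm_in_Hom G.Fm_Id G.Fm_Comp)
qed

text \<open>Since \<open>same_module\<close> fixes the carriers, \<open>U\<close> and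
  \<open>V\<close> have the same pair of identity functions, and this pair is its own
  inverse.\<close>

lemma TMF_identity_iso:
  assumes U: "U \<in> Obj (TMF K A f)"
    and src: "same_module A (src U) (src V)" and tgt: "same_module A (tgt U) (tgt V)"
    and phi: "phi V = phi U"
  shows "is_iso (TMF K A f) U V (Id (TMF K A f) U)"
    and "is_iso (TMF K A f) V U (Id (TMF K A f) U)"
proof -
  let ?i = "Id (TMF K A f) U"
  have mods: "graded_left_module A (src U)" "graded_left_module A (tgt U)"
    and phiU: "phi U \<in> graded_hom A (src U) (tgt U)"
    using U by (auto simp: TMF_def twisted_matrix_factorization_def fg_graded_free_def)
  have carriers: "carrier (src V) = carrier (src U)" "carrier (tgt V) = carrier (tgt U)"
    using src tgt by (simp_all add: same_module_def)
  have idem: "compose S (\<lambda>x\<in>S. x) (\<lambda>x\<in>S. x) = (\<lambda>x\<in>S. x)" for S :: "'b set"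
    by (auto simp: compose_def)
  have hom: "?i \<in> Hom (TMF K A f) U V" "?i \<in> Hom (TMF K A f) V U"
    using identity_graded_hom[OF mods(1) src] identity_graded_hom[OF mods(2) tgt]
      graded_homD(1)[OF phiU]
    by (auto simp: TMF_def phi carriers compose_def restrict_def)
  moreover have "Comp (TMF K A f) U V U ?i ?i = Id (TMF K A f) U"
    "Comp (TMF K A f) V U V ?i ?i = Id (TMF K A f) V"
    "Id (TMF K A f) V = Id (TMF K A f) U"
    by (simp_all add: TMF_def carriers idem)
  ultimately show "is_iso (TMF K A f) U V ?i" "is_iso (TMF K A f) V U ?i"
    unfolding is_iso_def by metis+
qed

definition twist_factorization ::
    "(int \<Rightarrow> 'a \<Rightarrow> 'a) \<Rightarrow> ('a, 'm) factorization \<Rightarrow> ('a, 'm) factorization" where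
  "twist_factorization \<rho> U =
     \<lparr>src = twist_module \<rho> (src U), tgt = twist_module \<rho> (tgt U), phi = phi U, tau = tau U\<rparr>"

lemma twist_factorization_simps [simp]:
  "src (twist_factorization \<rho> U) = twist_module \<rho> (src U)"
  "tgt (twist_factorization \<rho> U) = twist_module \<rho> (tgt U)"
  "phi (twist_factorization \<rho> U) = phi U" "tau (twist_factorization \<rho> U) = tau U"
  by (simp_all add: twist_factorization_def)

text \<open>A map of degree 0 keeps the degree \<open>i\<close> of its argument, so the scalar is
  changed by the same \<open>\<rho> i\<close> on both sides.\<close>

lemma (in twisted_algebras) graded_hom_twist:
  assumes M: "graded_left_module A M" and N: "graded_left_module A N"
    and \<phi>: "\<phi> \<in> graded_hom A M N"
  shows "\<phi> \<in> graded_hom B (twist_module \<rho> M) (twist_module \<rho> N)"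
proof -
  interpret M: graded_left_module A M by fact
  interpret gr: graded_group M by (rule M.graded_group)
  note \<phi>D = graded_homD[OF \<phi>]
  have "\<phi> (a \<odot>\<^bsub>twist_module \<rho> M\<^esub> x) = a \<odot>\<^bsub>twist_module \<rho> N\<^esub> \<phi> x"
    if a: "a \<in> carrier A" and x: "x \<in> carrier M" for a x
    using x
  proof (induction x rule: gr.homogeneous_induct)
    case (homogeneous i x)
    then show ?case
      using a \<phi>D(5)[OF homogeneous]
      by (simp add: twist_module_smult(2)[OF M] twist_module_smult(2)[OF N] \<phi>D(4) \<rho>_closed
          gr.grade_closed)
  next
    case (add x y)
    then show ?case
      using a by (simp add: twist_module_smult(1,3)[OF M] twist_module_smult(3)[OF N] \<phi>D(1,3))
  qed
  with \<phi>D show ?thesis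
    by (auto simp: graded_hom_def PiE_iff)
qed

text \<open>On degree \<open>i\<close> the scalar becomes \<open>\<rho> i (\<rho> (- i) a)\<close>,
  that is \<open>a\<close>. The conclusion is \<open>same_module\<close> because the records may
  still differ in scalar multiplication off the carriers.\<close>

lemma (in twisted_algebras) twist_module_twist_module:
  assumes M: "graded_left_module A M"
  shows "same_module A M (twist_module (\<lambda>n. \<rho> (- n)) (twist_module \<rho> M))"
proof -
  interpret M: graded_left_module A M by fact
  interpret gr: graded_group M by (rule M.graded_group)
  note smult = twist_module_smult[OF M]
    twisted_algebras.twist_module_smult[OF twisted_algebras_sym graded_left_module_twist[OF M], simplified]
  have "a \<odot>\<^bsub>twist_module (\<lambda>n. \<rho> (- n)) (twist_module \<rho> M)\<^esub> x = a \<odot>\<^bsub>M\<^esub> x"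
    if a: "a \<in> carrier A" and x: "x \<in> carrier M" for a x
    using x
  proof (induction x rule: gr.homogeneous_induct)
    case (homogeneous i x)
    then show ?case
      using a by (simp add: smult \<rho>_closed \<rho>_comp \<rho>_zero)
  next
    case (add x y)
    then show ?case
      using a by (simp add: smult M.smult_r_distr)
  qed
  then show ?thesis
    by (simp add: same_module_def)
qed

text \<open>The axioms are chosen to survive the exchange of \<open>A\<close> and \<open>B\<close>.
  In the application the normalizing automorphism over \<open>A\<close> is \<open>\<rho> 1\<close>,
  but that relation is lost under the exchange, whereas \<open>normalizing_commute\<close> and
  \<open>normalizing_B\<close> persist.\<close>

locale twisted_factorizations = twisted_algebras A B \<rho>
  for A B :: "(nat, 'k, 'a) graded_module" and \<rho> +
  fixes K :: "'k ring" and f :: 'a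
  assumes f_closed: "f \<in> carrier A" and \<rho>_f: "\<rho> n f = f"
    and normalizing_closed: "a \<in> carrier A \<Longrightarrow> normalizing_automorphism K A f a \<in> carrier A"
    and normalizing_commute: "a \<in> carrier A \<Longrightarrow>
      normalizing_automorphism K A f (\<rho> n a) = \<rho> n (normalizing_automorphism K A f a)"
    and normalizing_B: "a \<in> carrier A \<Longrightarrow>
      normalizing_automorphism K B f a = \<rho> (int (deg_of A f)) (normalizing_automorphism K A f a)"
begin

lemma deg_of_B: "deg_of B f = deg_of A f"
  by (simp add: deg_of_def)

text \<open>Applying \<open>\<rho> (- d)\<close>, with \<open>d\<close> the degree of
  \<open>f\<close>, to \<open>normalizing_B\<close> expresses the normalizing automorphism over
  \<open>A\<close> by the one over \<open>B\<close>.\<close>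

lemma twisted_factorizations_sym: "twisted_factorizations B A (\<lambda>n. \<rho> (- n)) K f"
  using f_closed
  by (intro twisted_factorizations.intro twisted_factorizations_axioms.intro twisted_algebras_sym)
    (simp_all add: \<rho>_f normalizing_B normalizing_closed normalizing_commute \<rho>_closed \<rho>_comp \<rho>_zero
      deg_of_B add.commute)

text \<open>On elements of degree \<open>j\<close> of the module, both orders of twisting let \<open>a\<close> act as
  \<open>\<rho> (j + d) (\<sigma> a)\<close>, where \<open>\<sigma>\<close> is the normalizing automorphism and \<open>d\<close> the degree of \<open>f\<close>.\<close>

lemma graded_hom_tw_twist:
  assumes M: "graded_left_module A M" and N: "graded_left_module A N"
    and \<phi>: "\<phi> \<in> graded_hom A (tw K A f M) N"
  shows "\<phi> \<in> graded_hom B (tw K B f (twist_module \<rho> M)) (twist_module \<rho> N)"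
proof -
  let ?d = "int (deg_of A f)"
  let ?\<sigma> = "normalizing_automorphism K A f"
  interpret M: graded_left_module A M by fact
  interpret gr: graded_group M by (rule M.graded_group)
  note \<phi>D = graded_homD[OF \<phi>, unfolded tw_def shift_def restrict_scalars_along_def, simplified]
  \<comment> \<open>By \<open>normalizing_B\<close>, \<open>\<rho> ?d (?\<sigma> a)\<close> is the
    scalar by which \<open>a\<close> acts in the \<open>tw\<close> formed over
    \<open>B\<close>.\<close>
  have "\<phi> (\<rho> ?d (?\<sigma> a) \<odot>\<^bsub>twist_module \<rho> M\<^esub> x) = a \<odot>\<^bsub>twist_module \<rho> N\<^esub> \<phi> x"
    if a: "a \<in> carrier A" and x: "x \<in> carrier M" for a x
    using x
  proof (induction x rule: gr.homogeneous_induct)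
    case (homogeneous j x)
    \<comment> \<open>The shift by \<open>- ?d\<close> puts an element of degree \<open>j\<close> of
      \<open>M\<close> into degree \<open>j + ?d\<close> of \<open>tw K A f M\<close>, and
      \<open>\<phi>\<close> preserves that degree.\<close>
    have "\<phi> x \<in> grade N (j + ?d)"
      using \<phi>D(5)[of x "j + ?d"] homogeneous by simp
    then have "a \<odot>\<^bsub>twist_module \<rho> N\<^esub> \<phi> x = \<rho> (j + ?d) a \<odot>\<^bsub>N\<^esub> \<phi> x"
      using a by (simp add: twist_module_smult(2)[OF N])
    \<comment> \<open>Linearity of \<open>\<phi>\<close> over \<open>A\<close>, read from right to
      left; on \<open>tw K A f M\<close> a scalar acts through \<open>?\<sigma>\<close>.\<close>
    also have "\<dots> = \<phi> (?\<sigma> (\<rho> (j + ?d) a) \<odot>\<^bsub>M\<^esub> x)"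
      using a homogeneous by (simp add: \<phi>D(4) \<rho>_closed gr.grade_closed)
    also have "\<dots> = \<phi> (\<rho> ?d (?\<sigma> a) \<odot>\<^bsub>twist_module \<rho> M\<^esub> x)"
      using a homogeneous
      by (simp add: twist_module_smult(2)[OF M] normalizing_commute normalizing_closed \<rho>_closed \<rho>_comp)
    finally show ?case ..
  next
    case (add x y)
    then show ?case
      using a
      by (simp add: twist_module_smult(1,3)[OF M] twist_module_smult(3)[OF N] \<phi>D(1,3) \<rho>_closed
          normalizing_closed)
  qed
  with \<phi>D show ?thesis
    by (auto simp: graded_hom_def PiE_iff tw_def shift_def restrict_scalars_along_def normalizing_B deg_of_B)
qed

text \<open>The maps and the carriers are kept, so both composites are literally the old ones, and
  \<open>left_mult_twist\<close> identifies the right-hand sides.\<close>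

lemma twist_factorization_in_Obj:
  assumes "U \<in> Obj (TMF K A f)"
  shows "twist_factorization \<rho> U \<in> Obj (TMF K B f)"
proof -
  have mods: "graded_left_module A (src U)" "graded_left_module A (tgt U)"
    using assms by (simp_all add: TMF_def twisted_matrix_factorization_def fg_graded_free_def)
  with assms show ?thesis
    by (simp add: TMF_def twisted_matrix_factorization_def fg_graded_free_twist graded_hom_twist
        graded_hom_tw_twist left_mult_twist f_closed \<rho>_f)
qed

text \<open>\<open>Id\<close> and \<open>Comp\<close> depend on the objects only through carriers,
  which twisting keeps. What remains is linearity over \<open>B\<close>, from
  \<open>graded_hom_twist\<close>.\<close>

lemma cat_functor_twist:
  "cat_functor (TMF K A f) (TMF K B f) (twist_factorization \<rho>) (\<lambda>U V g. g)"
proof (intro cat_functor.intro cat_functor_axioms.intro category_TMF)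
  show "g \<in> Hom (TMF K B f) (twist_factorization \<rho> U) (twist_factorization \<rho> V)"
    if "U \<in> Obj (TMF K A f)" "V \<in> Obj (TMF K A f)" "g \<in> Hom (TMF K A f) U V" for U V g
  proof -
    have "graded_left_module A (src U)" "graded_left_module A (tgt U)"
      "graded_left_module A (src V)" "graded_left_module A (tgt V)"
      using that by (simp_all add: TMF_def twisted_matrix_factorization_def fg_graded_free_def)
    with that(3) show ?thesis
      by (auto simp: TMF_def graded_hom_twist)
  qed
qed (simp_all add: twist_factorization_in_Obj, simp_all add: TMF_def)

text \<open>Identity maps compare \<open>U\<close> with its double twist. Both directions are given:
  one serves as the unit over \<open>A\<close>, the other, after exchanging the algebras, as the
  counit over \<open>B\<close>.\<close>

lemma natural_iso_twist_twist:
  defines "T \<equiv> \<lambda>U. twist_factorization (\<lambda>n. \<rho> (- n)) (twist_factorization \<rho> U)"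
  shows "natural_iso (TMF K A f) (TMF K A f) (\<lambda>U. U) (\<lambda>U V g. g) T (\<lambda>U V g. g) (Id (TMF K A f))"
    and "natural_iso (TMF K A f) (TMF K A f) T (\<lambda>U V g. g) (\<lambda>U. U) (\<lambda>U V g. g) (Id (TMF K A f))"
proof -
  note sym = twisted_factorizations_sym
  have functors: "cat_functor (TMF K A f) (TMF K A f) (\<lambda>U. U) (\<lambda>U V g. g)"
    "cat_functor (TMF K A f) (TMF K A f) T (\<lambda>U V g. g)"
    using cat_functor_compose[OF cat_functor_twist
        twisted_factorizations.cat_functor_twist[OF sym]]
    by (simp_all add: identity_functor category_TMF T_def)
  have isos: "is_iso (TMF K A f) U (T U) (Id (TMF K A f) U)"
    "is_iso (TMF K A f) (T U) U (Id (TMF K A f) U)"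
    if U: "U \<in> Obj (TMF K A f)" for U
  proof -
    have "graded_left_module A (src U)" "graded_left_module A (tgt U)"
      using U by (auto simp: TMF_def twisted_matrix_factorization_def fg_graded_free_def)
    then show "is_iso (TMF K A f) U (T U) (Id (TMF K A f) U)"
      "is_iso (TMF K A f) (T U) U (Id (TMF K A f) U)"
      using TMF_identity_iso[OF U, of "T U"] by (simp_all add: T_def twist_module_twist_module)
  qed
  \<comment> \<open>One statement for both directions: \<open>Comp\<close> takes carriers from its
    first object, and \<open>U\<close> and \<open>T U\<close> have the same carriers.\<close>
  have natural: "Comp (TMF K A f) U' V' V'' (Id (TMF K A f) V) g =
      Comp (TMF K A f) U' U'' V'' g (Id (TMF K A f) U)"
    if "g \<in> Hom (TMF K A f) U V" "U' = U \<or> U' = T U" "V' = V \<or> V' = T V"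
    for U V g U' U'' V' V''
    using that by (auto simp: TMF_def T_def graded_hom_def compose_identity)
  show "natural_iso (TMF K A f) (TMF K A f) (\<lambda>U. U) (\<lambda>U V g. g) T (\<lambda>U V g. g) (Id (TMF K A f))"
    "natural_iso (TMF K A f) (TMF K A f) T (\<lambda>U V g. g) (\<lambda>U. U) (\<lambda>U V g. g) (Id (TMF K A f))"
    by (intro natural_iso.intro natural_iso_axioms.intro functors isos natural; simp)+
qed

theorem equivalent_categories_twist:
  "equivalent_categories (TMF K A f :: (('a, 'm) factorization, _) cat)
     (TMF K B f :: (('a, 'm) factorization, _) cat)"
proof -
  note sym = twisted_factorizations_sym
  show ?thesis
    unfolding equivalent_categories_def
    \<comment> \<open>In the exchanged instances the inverse family is
      \<open>\<rho> (- (- n))\<close>, which simplifies to \<open>\<rho> n\<close>.\<close>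
    using category_TMF cat_functor_twist twisted_factorizations.cat_functor_twist[OF sym] natural_iso_twist_twist(1)
      twisted_factorizations.natural_iso_twist_twist(2)[OF sym]
    by (intro conjI exI[of _ "twist_factorization \<rho>"] exI[of _ "\<lambda>U V g. g"]
        exI[of _ "twist_factorization (\<lambda>n. \<rho> (- n))"] exI[of _ "Id (TMF K A f)"]
        exI[of _ "Id (TMF K B f)"]) simp_all
qed

end


section \<open>Normalizing automorphisms and the Zhang twist\<close>

lemma graded_algebra_autsD:
  assumes "\<sigma> \<in> graded_algebra_auts K A"
  shows "\<sigma> \<in> Bij (carrier A)"
    and "a \<in> carrier A \<Longrightarrow> \<sigma> a \<in> carrier A"
    and "\<lbrakk>a \<in> carrier A; b \<in> carrier A\<rbrakk> \<Longrightarrow> \<sigma> (a \<oplus>\<^bsub>A\<^esub> b) = \<sigma> a \<oplus>\<^bsub>A\<^esub> \<sigma> b"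
    and "\<lbrakk>a \<in> carrier A; b \<in> carrier A\<rbrakk> \<Longrightarrow> \<sigma> (a \<otimes>\<^bsub>A\<^esub> b) = \<sigma> a \<otimes>\<^bsub>A\<^esub> \<sigma> b"
    and "\<sigma> \<one>\<^bsub>A\<^esub> = \<one>\<^bsub>A\<^esub>"
    and "\<lbrakk>c \<in> carrier K; a \<in> carrier A\<rbrakk> \<Longrightarrow> \<sigma> (c \<odot>\<^bsub>A\<^esub> a) = c \<odot>\<^bsub>A\<^esub> \<sigma> a"
    and "\<sigma> ` grade A i = grade A i"
  using assms by (auto simp: graded_algebra_auts_def ring_hom_def)

lemma BijGroup_mult: "\<lbrakk>g \<in> Bij S; h \<in> Bij S\<rbrakk> \<Longrightarrow> g \<otimes>\<^bsub>BijGroup S\<^esub> h = compose S g h"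
  by (simp add: BijGroup_def)

text \<open>Left cancellation of \<open>f\<close> determines the values on the carrier, and members
  of \<open>Bij\<close> are extensional. Applied both to \<open>A\<close> and to its Zhang
  twist.\<close>

lemma normalizing_automorphism_eqI:
  assumes "ring A" and f: "f \<in> carrier A"
    and cancel: "\<And>a. \<lbrakk>a \<in> carrier A; f \<otimes>\<^bsub>A\<^esub> a = \<zero>\<^bsub>A\<^esub>\<rbrakk> \<Longrightarrow> a = \<zero>\<^bsub>A\<^esub>"
    and \<sigma>: "\<sigma> \<in> graded_algebra_auts K A" "\<And>a. a \<in> carrier A \<Longrightarrow> a \<otimes>\<^bsub>A\<^esub> f = f \<otimes>\<^bsub>A\<^esub> \<sigma> a"
  shows "normalizing_automorphism K A f = \<sigma>"
  unfolding normalizing_automorphism_def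
proof (rule the_equality)
  interpret A: ring A by fact
  show "\<sigma> \<in> graded_algebra_auts K A \<and> (\<forall>a \<in> carrier A. a \<otimes>\<^bsub>A\<^esub> f = f \<otimes>\<^bsub>A\<^esub> \<sigma> a)"
    using \<sigma> by blast
  fix \<tau>
  assume \<tau>: "\<tau> \<in> graded_algebra_auts K A \<and> (\<forall>a \<in> carrier A. a \<otimes>\<^bsub>A\<^esub> f = f \<otimes>\<^bsub>A\<^esub> \<tau> a)"
  show "\<tau> = \<sigma>"
  proof (rule extensionalityI)
    show "\<tau> \<in> extensional (carrier A)" "\<sigma> \<in> extensional (carrier A)"
      using \<tau> \<sigma> graded_algebra_autsD(1) Bij_imp_extensional by metis+
    fix a assume a: "a \<in> carrier A"
    have closed: "\<tau> a \<in> carrier A" "\<sigma> a \<in> carrier A"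
      using \<tau> \<sigma>(1) a graded_algebra_autsD(2) by metis+
    have "f \<otimes>\<^bsub>A\<^esub> (\<tau> a \<ominus>\<^bsub>A\<^esub> \<sigma> a) = \<zero>\<^bsub>A\<^esub>"
      using \<tau> \<sigma>(2)[OF a] a f closed
      by (metis A.minus_eq A.r_distr A.r_minus A.r_neg A.m_closed A.a_inv_closed)
    then show "\<tau> a = \<sigma> a"
      using cancel[of "\<tau> a \<ominus>\<^bsub>A\<^esub> \<sigma> a"] closed by (simp add: A.r_right_minus_eq)
  qed
qed

section \<open>Degrees and graded automorphisms of a connected algebra\<close>

context connected_graded_algebra
begin

interpretation gr: graded_group A by (rule graded_group)

lemma one_in_grade: "\<one>\<^bsub>A\<^esub> \<in> grade A 0"
proof -
  have "\<one>\<^bsub>K\<^esub> \<odot>\<^bsub>A\<^esub> \<one>\<^bsub>A\<^esub> \<in> grade A 0"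
    using bij_betwE[OF connected] by blast
  then show ?thesis
    by (simp add: vs.smult_one)
qed

lemma one_not_zero: "\<one>\<^bsub>A\<^esub> \<noteq> \<zero>\<^bsub>A\<^esub>"
proof
  assume "\<one>\<^bsub>A\<^esub> = \<zero>\<^bsub>A\<^esub>"
  then have "\<one>\<^bsub>K\<^esub> \<odot>\<^bsub>A\<^esub> \<one>\<^bsub>A\<^esub> = \<zero>\<^bsub>K\<^esub> \<odot>\<^bsub>A\<^esub> \<one>\<^bsub>A\<^esub>"
    by simp
  then have "\<one>\<^bsub>K\<^esub> = \<zero>\<^bsub>K\<^esub>"
    using inj_onD[OF bij_betw_imp_inj_on[OF connected], of "\<one>\<^bsub>K\<^esub>" "\<zero>\<^bsub>K\<^esub>"] by simp
  then show False
    by simp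
qed

text \<open>Ensures that \<open>deg_of\<close> is meaningful at \<open>f\<close>, since
  \<open>\<zero>\<close> lies in every grade. In a zero ring \<open>\<zero>\<close> would be
  regular; connectedness over a field excludes this.\<close>

lemma regular_nonzero: "regular_element A f \<Longrightarrow> f \<noteq> \<zero>\<^bsub>A\<^esub>"
  using one_not_zero unfolding regular_element_def by (metis A.l_null A.one_closed)

lemma deg_of_eqI: "\<lbrakk>x \<in> grade A d; x \<noteq> \<zero>\<^bsub>A\<^esub>\<rbrakk> \<Longrightarrow> deg_of A x = d"
  unfolding deg_of_def using gr.grade_disjoint by (intro the_equality)

text \<open>An injective additive map that raises degrees by \<open>d\<close> carries components to
  components, hence also reflects degrees. It is applied to left and right multiplication by
  \<open>f\<close>.\<close>

lemma grade_if_image_grade: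
  assumes closed: "\<And>x. x \<in> carrier A \<Longrightarrow> h x \<in> carrier A"
    and additive: "\<And>x y. \<lbrakk>x \<in> carrier A; y \<in> carrier A\<rbrakk> \<Longrightarrow> h (x \<oplus>\<^bsub>A\<^esub> y) = h x \<oplus>\<^bsub>A\<^esub> h y"
    and graded: "\<And>i x. x \<in> grade A i \<Longrightarrow> h x \<in> grade A (i + d)"
    and kernel: "\<And>x. \<lbrakk>x \<in> carrier A; h x = \<zero>\<^bsub>A\<^esub>\<rbrakk> \<Longrightarrow> x = \<zero>\<^bsub>A\<^esub>"
    and x: "x \<in> carrier A" "h x \<in> grade A (i + d)"
  shows "x \<in> grade A i"
proof -
  have h0: "h \<zero>\<^bsub>A\<^esub> = \<zero>\<^bsub>A\<^esub>"
    using additive[of "\<zero>\<^bsub>A\<^esub>" "\<zero>\<^bsub>A\<^esub>"] closed[of "\<zero>\<^bsub>A\<^esub>"] by (simp add: A.add.l_cancel_one')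
  have comp: "component A (h x) (j + d) = h (component A x j)" for j
    using x(1)
  proof (induction x rule: gr.homogeneous_induct)
    case (homogeneous k x)
    then show ?case
      using gr.component_homogeneous[OF graded[OF homogeneous]] gr.component_homogeneous[OF homogeneous]
      by (simp add: h0)
  next
    case (add x y)
    then show ?case
      by (simp add: additive closed gr.component_add gr.component_closed)
  qed
  have "component A x j = \<zero>\<^bsub>A\<^esub>" if "j \<noteq> i" for j
    using comp[of j] kernel[OF gr.component_closed[OF x(1)], of j] that
    by (simp add: gr.component_homogeneous[OF x(2)])
  then have "x = (\<Oplus>\<^bsub>A\<^esub>j\<in>{i}. component A x j)"
    by (intro gr.sum_components_superset) (use x(1) in auto)
  also have "\<dots> = component A x i"
    using x(1) gr.component_closed by (simp add: A.finsum_insert A.finsum_empty)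
  finally have eq: "x = component A x i" .
  show ?thesis
    by (subst eq) (rule gr.component_grade[OF x(1)])
qed

text \<open>Normality solves \<open>a f = f b\<close> for \<open>b\<close>, and regularity makes the
  solution unique. Each algebraic law for the resulting map is checked after multiplying by
  \<open>f\<close> on the left.\<close>

lemma normalizing_automorphism:
  assumes f: "f \<in> grade A d" "normal_element A f" "regular_element A f"
  shows "normalizing_automorphism K A f \<in> graded_algebra_auts K A"
    and "a \<in> carrier A \<Longrightarrow> a \<otimes>\<^bsub>A\<^esub> f = f \<otimes>\<^bsub>A\<^esub> normalizing_automorphism K A f a"
proof -
  have fc: "f \<in> carrier A"
    using f(1) gr.grade_closed by blast
  have left0: "\<And>a. \<lbrakk>a \<in> carrier A; f \<otimes>\<^bsub>A\<^esub> a = \<zero>\<^bsub>A\<^esub>\<rbrakk> \<Longrightarrow> a = \<zero>\<^bsub>A\<^esub>"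
    and right0: "\<And>a. \<lbrakk>a \<in> carrier A; a \<otimes>\<^bsub>A\<^esub> f = \<zero>\<^bsub>A\<^esub>\<rbrakk> \<Longrightarrow> a = \<zero>\<^bsub>A\<^esub>"
    using f(3) unfolding regular_element_def by blast+
  have left: "a = b" if "f \<otimes>\<^bsub>A\<^esub> a = f \<otimes>\<^bsub>A\<^esub> b" "a \<in> carrier A" "b \<in> carrier A" for a b
  proof -
    have "f \<otimes>\<^bsub>A\<^esub> (a \<ominus>\<^bsub>A\<^esub> b) = \<zero>\<^bsub>A\<^esub>"
      using that fc by (simp add: A.minus_eq A.r_distr A.r_minus A.r_neg)
    then show ?thesis
      using left0[of "a \<ominus>\<^bsub>A\<^esub> b"] that by (simp add: A.r_right_minus_eq)
  qed
  have right: "a = b" if "a \<otimes>\<^bsub>A\<^esub> f = b \<otimes>\<^bsub>A\<^esub> f" "a \<in> carrier A" "b \<in> carrier A" for a b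
  proof -
    have "(a \<ominus>\<^bsub>A\<^esub> b) \<otimes>\<^bsub>A\<^esub> f = \<zero>\<^bsub>A\<^esub>"
      using that fc by (simp add: A.minus_eq A.l_distr A.l_minus A.r_neg)
    then show ?thesis
      using right0[of "a \<ominus>\<^bsub>A\<^esub> b"] that by (simp add: A.r_right_minus_eq)
  qed
  have normal: "(\<lambda>a. f \<otimes>\<^bsub>A\<^esub> a) ` carrier A = (\<lambda>a. a \<otimes>\<^bsub>A\<^esub> f) ` carrier A"
    using f(2) by (simp add: normal_element_def)
  have "\<exists>b. b \<in> carrier A \<and> a \<otimes>\<^bsub>A\<^esub> f = f \<otimes>\<^bsub>A\<^esub> b" if "a \<in> carrier A" for a
  proof -
    have "a \<otimes>\<^bsub>A\<^esub> f \<in> (\<lambda>a. f \<otimes>\<^bsub>A\<^esub> a) ` carrier A"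
      unfolding normal using that by (rule imageI)
    then show ?thesis
      by blast
  qed
  then obtain s where s: "\<And>a. a \<in> carrier A \<Longrightarrow> s a \<in> carrier A"
    "\<And>a. a \<in> carrier A \<Longrightarrow> a \<otimes>\<^bsub>A\<^esub> f = f \<otimes>\<^bsub>A\<^esub> s a"
    by metis
  \<comment> \<open>Restriction provides the extensionality that \<open>Bij\<close> demands.\<close>
  define \<sigma> where "\<sigma> = restrict s (carrier A)"
  have \<sigma>: "\<sigma> a \<in> carrier A" "a \<otimes>\<^bsub>A\<^esub> f = f \<otimes>\<^bsub>A\<^esub> \<sigma> a" if "a \<in> carrier A" for a
    unfolding \<sigma>_def using s(1)[OF that] s(2)[OF that] that by simp_all
  have surj: "\<exists>a \<in> carrier A. \<sigma> a = b" if b: "b \<in> carrier A" for b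
  proof -
    have "f \<otimes>\<^bsub>A\<^esub> b \<in> (\<lambda>a. a \<otimes>\<^bsub>A\<^esub> f) ` carrier A"
      unfolding normal[symmetric] using b by (rule imageI)
    then obtain a where a: "a \<in> carrier A" "f \<otimes>\<^bsub>A\<^esub> b = a \<otimes>\<^bsub>A\<^esub> f"
      by blast
    have "\<sigma> a = b"
      by (rule left) (use a b \<sigma>(1) \<sigma>(2)[OF a(1)] in auto)
    with a(1) show ?thesis
      by blast
  qed
  have "inj_on \<sigma> (carrier A)"
  proof (rule inj_onI)
    fix a b assume ab: "a \<in> carrier A" "b \<in> carrier A" "\<sigma> a = \<sigma> b"
    then show "a = b"
      using right[OF _ ab(1,2)] \<sigma>(2)[OF ab(1)] \<sigma>(2)[OF ab(2)] by simp
  qed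
  moreover have "\<sigma> ` carrier A = carrier A"
    using surj \<sigma>(1) by blast
  ultimately have "\<sigma> \<in> Bij (carrier A)"
    by (simp add: Bij_def bij_betw_def \<sigma>_def)
  moreover have "\<sigma> \<in> ring_hom A A"
  proof (rule ring_hom_memI)
    show "\<sigma> (a \<oplus>\<^bsub>A\<^esub> b) = \<sigma> a \<oplus>\<^bsub>A\<^esub> \<sigma> b" if "a \<in> carrier A" "b \<in> carrier A" for a b
      by (rule left) (use that fc \<sigma>(1) in \<open>simp_all add: A.r_distr A.l_distr flip: \<sigma>(2)\<close>)
    show "\<sigma> (a \<otimes>\<^bsub>A\<^esub> b) = \<sigma> a \<otimes>\<^bsub>A\<^esub> \<sigma> b" if ab: "a \<in> carrier A" "b \<in> carrier A" for a b
    proof (rule left)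
      have "f \<otimes>\<^bsub>A\<^esub> \<sigma> (a \<otimes>\<^bsub>A\<^esub> b) = a \<otimes>\<^bsub>A\<^esub> (b \<otimes>\<^bsub>A\<^esub> f)"
        using ab fc by (simp add: A.m_assoc flip: \<sigma>(2))
      also have "\<dots> = (a \<otimes>\<^bsub>A\<^esub> f) \<otimes>\<^bsub>A\<^esub> \<sigma> b"
        using ab fc \<sigma>(1) by (simp add: A.m_assoc \<sigma>(2)[OF ab(2)])
      also have "\<dots> = f \<otimes>\<^bsub>A\<^esub> (\<sigma> a \<otimes>\<^bsub>A\<^esub> \<sigma> b)"
        using ab fc \<sigma>(1) by (simp add: A.m_assoc \<sigma>(2)[OF ab(1)])
      finally show "f \<otimes>\<^bsub>A\<^esub> \<sigma> (a \<otimes>\<^bsub>A\<^esub> b) = f \<otimes>\<^bsub>A\<^esub> (\<sigma> a \<otimes>\<^bsub>A\<^esub> \<sigma> b)" .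
    qed (use ab \<sigma>(1) in auto)
    show "\<sigma> \<one>\<^bsub>A\<^esub> = \<one>\<^bsub>A\<^esub>"
      by (rule left) (use fc \<sigma>(1) in \<open>simp_all flip: \<sigma>(2)\<close>)
  qed (use \<sigma> in auto)
  moreover have "\<sigma> (c \<odot>\<^bsub>A\<^esub> a) = c \<odot>\<^bsub>A\<^esub> \<sigma> a" if "c \<in> carrier K" "a \<in> carrier A" for c a
    by (rule left) (use that fc \<sigma>(1) in \<open>simp_all add: smult_mult_left smult_mult_right flip: \<sigma>(2)\<close>)
  \<comment> \<open>If \<open>a\<close> has degree \<open>i\<close>, then so does
    \<open>\<sigma> a\<close>, since \<open>f (\<sigma> a) = a f\<close> has degree
    \<open>i + d\<close>. The converse inclusion cancels \<open>f\<close> on the right in the same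
    equation.\<close>
  moreover have "\<sigma> ` grade A i = grade A i" for i
  proof
    show "\<sigma> ` grade A i \<subseteq> grade A i"
    proof clarify
      fix a assume a: "a \<in> grade A i"
      have ac: "a \<in> carrier A" using a gr.grade_closed by blast
      show "\<sigma> a \<in> grade A i"
      proof (rule grade_if_image_grade[where h = "\<lambda>b. f \<otimes>\<^bsub>A\<^esub> b" and d = d])
        show "f \<otimes>\<^bsub>A\<^esub> \<sigma> a \<in> grade A (i + d)"
          using grade_mult[OF a f(1)] \<sigma>(2)[OF ac] by simp
        show "f \<otimes>\<^bsub>A\<^esub> x \<in> grade A (j + d)" if "x \<in> grade A j" for x j
          using grade_mult[OF f(1) that] by (simp add: add.commute)
        show "x = \<zero>\<^bsub>A\<^esub>" if "x \<in> carrier A" "f \<otimes>\<^bsub>A\<^esub> x = \<zero>\<^bsub>A\<^esub>" for x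
          using that by (rule left0)
      qed (use fc ac \<sigma>(1) in \<open>simp_all add: A.r_distr\<close>)
    qed
    show "grade A i \<subseteq> \<sigma> ` grade A i"
    proof
      fix b assume b: "b \<in> grade A i"
      have bc: "b \<in> carrier A" using b gr.grade_closed by blast
      then obtain a where a: "a \<in> carrier A" "\<sigma> a = b"
        using surj by blast
      have "a \<in> grade A i"
      proof (rule grade_if_image_grade[where h = "\<lambda>a. a \<otimes>\<^bsub>A\<^esub> f" and d = d])
        show "a \<otimes>\<^bsub>A\<^esub> f \<in> grade A (i + d)"
          using grade_mult[OF f(1) b] \<sigma>(2)[OF a(1)] a(2) by (simp add: add.commute)
        show "x \<otimes>\<^bsub>A\<^esub> f \<in> grade A (j + d)" if "x \<in> grade A j" for x j
          using grade_mult[OF that f(1)] .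
        show "x = \<zero>\<^bsub>A\<^esub>" if "x \<in> carrier A" "x \<otimes>\<^bsub>A\<^esub> f = \<zero>\<^bsub>A\<^esub>" for x
          using that by (rule right0)
      qed (use fc a in \<open>simp_all add: A.l_distr\<close>)
      then show "b \<in> \<sigma> ` grade A i"
        using a(2) by blast
    qed
  qed
  ultimately have aut: "\<sigma> \<in> graded_algebra_auts K A"
    by (simp add: graded_algebra_auts_def)
  have "normalizing_automorphism K A f = \<sigma>"
    by (rule normalizing_automorphism_eqI[OF A.ring_axioms fc left0 aut \<sigma>(2)])
  with aut \<sigma>(2) show "normalizing_automorphism K A f \<in> graded_algebra_auts K A"
    and "a \<in> carrier A \<Longrightarrow> a \<otimes>\<^bsub>A\<^esub> f = f \<otimes>\<^bsub>A\<^esub> normalizing_automorphism K A f a"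
    by simp_all
qed

text \<open>Makes all integer powers of a graded automorphism graded automorphisms, negative ones
  included.\<close>

lemma subgroup_graded_algebra_auts:
  "subgroup (graded_algebra_auts K A) (BijGroup (carrier A))"
proof (rule group.subgroupI[OF group_BijGroup])
  show "graded_algebra_auts K A \<subseteq> carrier (BijGroup (carrier A))"
    by (auto simp: BijGroup_def graded_algebra_auts_def)
  have "(\<lambda>x \<in> carrier A. x) \<in> graded_algebra_auts K A"
    using gr.grade_closed
    by (auto simp: graded_algebra_auts_def id_Bij ring_hom_def image_iff)
  then show "graded_algebra_auts K A \<noteq> {}"
    by blast
next
  fix \<sigma> assume \<sigma>: "\<sigma> \<in> graded_algebra_auts K A"
  note \<sigma>D = graded_algebra_autsD[OF \<sigma>]
  define \<tau> where "\<tau> = (\<lambda>x \<in> carrier A. inv_into (carrier A) \<sigma> x)"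
  have bij: "bij_betw \<sigma> (carrier A) (carrier A)"
    using \<sigma>D(1) by (simp add: Bij_def)
  have \<tau>_closed: "\<tau> x \<in> carrier A" and \<sigma>\<tau>: "\<sigma> (\<tau> x) = x" if "x \<in> carrier A" for x
    using that bij by (auto simp: \<tau>_def bij_betw_def intro!: inv_into_into f_inv_into_f)
  have \<tau>\<sigma>: "\<tau> (\<sigma> x) = x" if "x \<in> carrier A" for x
    using that bij \<sigma>D(2) by (simp add: \<tau>_def bij_betw_def)
  \<comment> \<open>Laws for the inverse are reduced to laws for \<open>\<sigma>\<close> by applying
    \<open>\<sigma>\<close> to both sides.\<close>
  have eqI: "\<tau> y = x" if "x \<in> carrier A" "\<sigma> x = y" for x y
    using that \<tau>\<sigma> by auto
  have "\<tau> \<in> ring_hom A A"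
    by (rule ring_hom_memI) (auto intro!: eqI simp: \<tau>_closed \<sigma>\<tau> \<sigma>D)
  moreover have "\<tau> (c \<odot>\<^bsub>A\<^esub> a) = c \<odot>\<^bsub>A\<^esub> \<tau> a" if "c \<in> carrier K" "a \<in> carrier A" for c a
    using that by (intro eqI) (simp_all add: \<tau>_closed \<sigma>\<tau> \<sigma>D)
  moreover have "\<tau> ` grade A i = grade A i" for i
  proof -
    have "\<tau> ` grade A i = \<tau> ` \<sigma> ` grade A i"
      by (simp add: \<sigma>D(7))
    also have "\<dots> = grade A i"
      using \<tau>\<sigma> gr.grade_closed by (force simp: image_image)
    finally show ?thesis .
  qed
  moreover have "\<tau> \<in> Bij (carrier A)"
    unfolding \<tau>_def by (rule restrict_inv_into_Bij[OF \<sigma>D(1)])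
  ultimately have "\<tau> \<in> graded_algebra_auts K A"
    by (simp add: graded_algebra_auts_def)
  then show "inv\<^bsub>BijGroup (carrier A)\<^esub> \<sigma> \<in> graded_algebra_auts K A"
    by (simp add: inv_BijGroup[OF \<sigma>D(1)] \<tau>_def)
next
  fix \<sigma> \<tau> assume \<sigma>: "\<sigma> \<in> graded_algebra_auts K A" and \<tau>: "\<tau> \<in> graded_algebra_auts K A"
  note \<sigma>D = graded_algebra_autsD[OF \<sigma>] and \<tau>D = graded_algebra_autsD[OF \<tau>]
  have "compose (carrier A) \<sigma> \<tau> ` grade A i = grade A i" for i
  proof -
    have "compose (carrier A) \<sigma> \<tau> ` grade A i = \<sigma> ` \<tau> ` grade A i"
      unfolding image_image by (rule image_cong) (auto simp: compose_eq gr.grade_closed)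
    then show ?thesis
      by (simp add: \<sigma>D(7) \<tau>D(7))
  qed
  then show "\<sigma> \<otimes>\<^bsub>BijGroup (carrier A)\<^esub> \<tau> \<in> graded_algebra_auts K A"
    using \<sigma>D \<tau>D by (auto simp: BijGroup_mult graded_algebra_auts_def compose_Bij ring_hom_def compose_eq)
qed

lemma twisting_system_of:
  assumes \<sigma>: "\<sigma> \<in> graded_algebra_auts K A"
  shows "twisting_system_of A \<sigma> n \<in> graded_algebra_auts K A"
    and "a \<in> carrier A \<Longrightarrow> twisting_system_of A \<sigma> 0 a = a"
    and "twisting_system_of A \<sigma> 1 = \<sigma>"
    and "a \<in> carrier A \<Longrightarrow> twisting_system_of A \<sigma> m (twisting_system_of A \<sigma> n a) =
      twisting_system_of A \<sigma> (m + n) a"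
proof -
  interpret G: group "BijGroup (carrier A)" by (rule group_BijGroup)
  have carrier: "\<sigma> \<in> carrier (BijGroup (carrier A))"
    using graded_algebra_autsD(1)[OF \<sigma>] by (simp add: BijGroup_def)
  show aut: "twisting_system_of A \<sigma> n \<in> graded_algebra_auts K A" for n
    unfolding twisting_system_of_def
    by (rule G.subgroup_int_pow_closed[OF subgroup_graded_algebra_auts \<sigma>])
  show "a \<in> carrier A \<Longrightarrow> twisting_system_of A \<sigma> 0 a = a"
    by (simp add: twisting_system_of_def) (simp add: BijGroup_def)
  show "twisting_system_of A \<sigma> 1 = \<sigma>"
    by (simp add: twisting_system_of_def carrier)
  show "a \<in> carrier A \<Longrightarrow> twisting_system_of A \<sigma> m (twisting_system_of A \<sigma> n a) =
      twisting_system_of A \<sigma> (m + n) a"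
    using G.int_pow_mult[OF carrier, of m n] BijGroup_mult[OF aut[THEN graded_algebra_autsD(1)]
        aut[THEN graded_algebra_autsD(1)], of m n]
    by (simp add: twisting_system_of_def compose_eq)
qed

lemma graded_automorphism_action:
  assumes "\<sigma> \<in> graded_algebra_auts K A"
  shows "graded_automorphism_action A (twisting_system_of A \<sigma>)"
proof (intro graded_automorphism_action.intro graded_automorphism_action_axioms.intro)
  note aut = graded_algebra_autsD[OF twisting_system_of(1)[OF assms]]
  show "twisting_system_of A \<sigma> n a \<in> grade A i" if "a \<in> grade A i" for n a i
    using aut(7) that by blast
qed (simp_all add: A.ring_axioms direct_sum twisting_system_of(2,4)[OF assms]
    graded_algebra_autsD[OF twisting_system_of(1)[OF assms]])

end

text \<open>For \<open>y\<close> of degree \<open>j\<close> and \<open>z\<close> of degree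
  \<open>i\<close>, both bracketings of \<open>x\<close>, \<open>y\<close>, \<open>z\<close> equal
  the product of \<open>\<rho> (i + j) x\<close>, \<open>\<rho> i y\<close> and \<open>z\<close> in
  \<open>A\<close>. The right unit law holds because the unit has degree 0, where the twist is
  trivial.\<close>

lemma (in graded_automorphism_action) twisted_algebras_zhang_twist:
  assumes grade_mult: "\<And>i j x y. \<lbrakk>x \<in> grade A i; y \<in> grade A j\<rbrakk> \<Longrightarrow> x \<otimes>\<^bsub>A\<^esub> y \<in> grade A (i + j)"
    and one: "\<one>\<^bsub>A\<^esub> \<in> grade A 0"
  shows "twisted_algebras A (zhang_twist A \<rho>) \<rho>"
proof -
  let ?B = "zhang_twist A \<rho>"
  have simps [simp]: "carrier ?B = carrier A" "add ?B = add A" "\<zero>\<^bsub>?B\<^esub> = \<zero>\<^bsub>A\<^esub>"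
    "\<one>\<^bsub>?B\<^esub> = \<one>\<^bsub>A\<^esub>" "grade ?B = grade A"
    by (simp_all add: zhang_twist_def)
  \<comment> \<open>With \<open>x\<close> fixed this yields closure, values and additivity in the
    right factor; additivity in the left factor needs an argument of its own.\<close>
  note ext = grA.component_sum_extension[OF A.abelian_group_axioms]
  have mult: "x \<otimes>\<^bsub>?B\<^esub> y \<in> carrier A" if "x \<in> carrier A" "y \<in> carrier A" for x y
    using that ext(1)[where h = "\<lambda>i y. \<rho> (int i) x \<otimes>\<^bsub>A\<^esub> y"]
    by (simp add: zhang_twist_def \<rho>_closed grA.grade_closed A.r_distr)
  have mult_homogeneous: "x \<otimes>\<^bsub>?B\<^esub> y = \<rho> (int j) x \<otimes>\<^bsub>A\<^esub> y"
    if "x \<in> carrier A" "y \<in> grade A j" for x y j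
    using that ext(2)[where h = "\<lambda>i y. \<rho> (int i) x \<otimes>\<^bsub>A\<^esub> y"]
    by (simp add: zhang_twist_def \<rho>_closed grA.grade_closed A.r_distr)
  have mult_add: "x \<otimes>\<^bsub>?B\<^esub> (y \<oplus>\<^bsub>A\<^esub> z) = x \<otimes>\<^bsub>?B\<^esub> y \<oplus>\<^bsub>A\<^esub> x \<otimes>\<^bsub>?B\<^esub> z"
    if "x \<in> carrier A" "y \<in> carrier A" "z \<in> carrier A" for x y z
    using that ext(3)[where h = "\<lambda>i y. \<rho> (int i) x \<otimes>\<^bsub>A\<^esub> y"]
    by (simp add: zhang_twist_def \<rho>_closed grA.grade_closed A.r_distr)
  have add_mult: "(x \<oplus>\<^bsub>A\<^esub> y) \<otimes>\<^bsub>?B\<^esub> z = x \<otimes>\<^bsub>?B\<^esub> z \<oplus>\<^bsub>A\<^esub> y \<otimes>\<^bsub>?B\<^esub> z"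
    if xy: "x \<in> carrier A" "y \<in> carrier A" and z: "z \<in> carrier A" for x y z
    using z
  proof (induction z rule: grA.homogeneous_induct)
    case (homogeneous i z)
    with xy show ?case
      by (simp add: mult_homogeneous \<rho>_add \<rho>_closed A.l_distr grA.grade_closed)
  next
    case (add u v)
    with xy show ?case
      by (simp add: mult_add mult A.a_ac)
  qed
  have assoc: "(x \<otimes>\<^bsub>?B\<^esub> y) \<otimes>\<^bsub>?B\<^esub> z = x \<otimes>\<^bsub>?B\<^esub> (y \<otimes>\<^bsub>?B\<^esub> z)"
    if x: "x \<in> carrier A" and y: "y \<in> carrier A" and z: "z \<in> carrier A" for x y z
    using z
  proof (induction z rule: grA.homogeneous_induct)
    case (homogeneous i z)
    then have zc: "z \<in> carrier A"
      by (simp add: grA.grade_closed)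
    show ?case
      using y
    proof (induction y rule: grA.homogeneous_induct)
      case h: (homogeneous j y)
      have "\<rho> (int i) y \<otimes>\<^bsub>A\<^esub> z \<in> grade A (j + i)"
        using h homogeneous by (simp add: grade_mult \<rho>_grade)
      with x h homogeneous zc show ?case
        by (simp add: mult_homogeneous grA.grade_closed \<rho>_closed \<rho>_mult \<rho>_comp A.m_assoc add.commute)
    next
      case (add u v)
      with x zc show ?case
        by (simp add: mult_add add_mult mult)
    qed
  next
    case (add u v)
    with x y show ?case
      by (simp add: mult_add mult)
  qed
  have one_left: "\<one>\<^bsub>A\<^esub> \<otimes>\<^bsub>?B\<^esub> x = x" if "x \<in> carrier A" for x
    using that
    by (induction x rule: grA.homogeneous_induct)
      (simp_all add: mult_homogeneous mult_add \<rho>_one grA.grade_closed)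
  have one_right: "x \<otimes>\<^bsub>?B\<^esub> \<one>\<^bsub>A\<^esub> = x" if "x \<in> carrier A" for x
    using that one by (simp add: mult_homogeneous \<rho>_zero)
  have "ring ?B"
  proof (rule ringI)
    show "abelian_group ?B"
      using A.abelian_group_axioms by (subst same_additive_group(3)[of ?B A]) simp_all
    show "monoid ?B"
      by (rule monoidI) (simp_all add: mult assoc one_left one_right)
  qed (simp_all add: mult_add add_mult)
  then show ?thesis
    by (intro twisted_algebras.intro twisted_algebras_axioms.intro graded_automorphism_action_axioms)
      (simp_all add: mult_homogeneous)
qed

lemma (in twisted_algebras) graded_algebra_auts_B:
  assumes "\<rho> n \<in> graded_algebra_auts K A" and "smult B = smult A"
  shows "\<rho> n \<in> graded_algebra_auts K B"
  using assms by (auto simp: graded_algebra_auts_def ring_hom_def \<rho>_mult_B)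

text \<open>The twist hits the left factor, which is fixed. So left cancellation of \<open>f\<close>
  carries over from \<open>A\<close> to \<open>B\<close>.\<close>

lemma (in twisted_algebras) mult_B_fixed:
  assumes "f \<in> carrier A" "\<And>n. \<rho> n f = f" "a \<in> carrier A"
  shows "f \<otimes>\<^bsub>B\<^esub> a = f \<otimes>\<^bsub>A\<^esub> a"
  using assms(3)
proof (induction a rule: grA.homogeneous_induct)
  case (add a b)
  then show ?case
    using assms(1) B.r_distr[of a b f] by (simp add: A.r_distr)
qed (simp add: mult_B assms)

text \<open>The crux is the normalizing automorphism over the twist: \<open>a\<close> times
  \<open>f\<close> there is \<open>\<rho> d a\<close> times \<open>f\<close> in \<open>A\<close>,
  and moving \<open>f\<close> to the left applies the old automorphism once more.\<close>

lemma twisted_factorizations_zhang_twist: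
  assumes A: "connected_graded_algebra K A"
    and f: "f \<in> grade A d" "normal_element A f" "regular_element A f"
  defines "\<rho> \<equiv> twisting_system_of A (normalizing_automorphism K A f)"
  shows "twisted_factorizations A (zhang_twist A \<rho>) \<rho> K f"
proof -
  let ?\<sigma> = "normalizing_automorphism K A f"
  let ?B = "zhang_twist A \<rho>"
  interpret connected_graded_algebra K A by fact
  interpret gr: graded_group A by (rule graded_group)
  note \<sigma> = normalizing_automorphism[OF f]
  note \<rho> = twisting_system_of[OF \<sigma>(1), folded \<rho>_def]
  interpret graded_automorphism_action A \<rho>
    unfolding \<rho>_def by (rule graded_automorphism_action[OF \<sigma>(1)])
  interpret twisted_algebras A ?B \<rho>
    by (rule twisted_algebras_zhang_twist) (simp_all add: grade_mult one_in_grade)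
  have fc: "f \<in> carrier A"
    using f(1) gr.grade_closed by blast
  have cancel: "a = \<zero>\<^bsub>A\<^esub>" if "a \<in> carrier A" "f \<otimes>\<^bsub>A\<^esub> a = \<zero>\<^bsub>A\<^esub>" for a
    using f(3) that unfolding regular_element_def by blast
  \<comment> \<open>Take \<open>a = f\<close> in the normalizing relation and cancel
    \<open>f\<close> on the left.\<close>
  have \<sigma>f: "?\<sigma> f = f"
  proof -
    have closed: "?\<sigma> f \<in> carrier A"
      using graded_algebra_autsD(2)[OF \<sigma>(1)] fc by blast
    then have "f \<otimes>\<^bsub>A\<^esub> (?\<sigma> f \<ominus>\<^bsub>A\<^esub> f) = \<zero>\<^bsub>A\<^esub>"
      using fc by (simp add: A.minus_eq A.r_distr A.r_minus A.r_neg flip: \<sigma>(2))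
    then show ?thesis
      using cancel[of "?\<sigma> f \<ominus>\<^bsub>A\<^esub> f"] fc closed by (simp add: A.r_right_minus_eq)
  qed
  have \<rho>_step: "\<rho> (n + 1) f = \<rho> n f" for n
    using \<rho>(4)[OF fc, of n 1] by (simp add: \<rho>(3) \<sigma>f)
  \<comment> \<open>The induction runs in both directions from 0, since negative powers occur as
    well.\<close>
  have \<rho>f: "\<rho> n f = f" for n
  proof (induction n rule: int_induct[where k = 0])
    case base
    show ?case using fc by (rule \<rho>_zero)
  next
    case (step1 i)
    then show ?case using \<rho>_step[of i] by simp
  next
    case (step2 i)
    then show ?case using \<rho>_step[of "i - 1"] by simp
  qed
  have deg: "deg_of A f = d"
    using f(1) regular_nonzero[OF f(3)] by (rule deg_of_eqI)
  \<comment> \<open>The summand \<open>d\<close> comes from the twisted product with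
    \<open>f\<close> on the right, the summand 1 from normalization in \<open>A\<close>.\<close>
  have "normalizing_automorphism K ?B f = \<rho> (1 + int d)"
  proof (rule normalizing_automorphism_eqI)
    show "\<rho> (1 + int d) \<in> graded_algebra_auts K ?B"
      by (rule graded_algebra_auts_B[OF \<rho>(1)]) (simp add: zhang_twist_def)
    show "a \<otimes>\<^bsub>?B\<^esub> f = f \<otimes>\<^bsub>?B\<^esub> \<rho> (1 + int d) a" if "a \<in> carrier ?B" for a
    proof -
      have a: "a \<in> carrier A" using that by simp
      have "a \<otimes>\<^bsub>?B\<^esub> f = \<rho> (int d) a \<otimes>\<^bsub>A\<^esub> f"
        using a f(1) by (rule mult_B)
      also have "\<dots> = f \<otimes>\<^bsub>A\<^esub> ?\<sigma> (\<rho> (int d) a)"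
        using a by (intro \<sigma>(2) \<rho>_closed)
      also have "?\<sigma> (\<rho> (int d) a) = \<rho> (1 + int d) a"
        using \<rho>(4)[OF a, of 1 "int d"] by (simp add: \<rho>(3))
      finally show ?thesis
        using a by (simp add: mult_B_fixed[OF fc \<rho>f] \<rho>_closed)
    qed
    show "a = \<zero>\<^bsub>?B\<^esub>" if "a \<in> carrier ?B" "f \<otimes>\<^bsub>?B\<^esub> a = \<zero>\<^bsub>?B\<^esub>" for a
      using that cancel[of a] by (simp add: mult_B_fixed[OF fc \<rho>f])
  qed (use fc B.ring_axioms in simp_all)
  then show ?thesis
    \<comment> \<open>As \<open>?\<sigma>\<close> is \<open>\<rho> 1\<close>, the two remaining
      axioms on normalizing automorphisms are composition laws with one exponent equal to 1.\<close>
    using \<rho>(4)[of _ 1] \<rho>(4)[of _ _ 1] fc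
    by (intro twisted_factorizations.intro twisted_factorizations_axioms.intro twisted_algebras_axioms)
      (simp_all add: \<rho>f \<rho>(3) deg \<rho>_closed graded_algebra_autsD(2)[OF \<sigma>(1)] add.commute)
qed

theorem theoremB:
  fixes K :: "'k ring"
    and A :: "(nat, 'k, 'a) graded_module"
    and f :: 'a and d :: nat
    and \<sigma> :: "'a \<Rightarrow> 'a" and \<zeta> :: "int \<Rightarrow> 'a \<Rightarrow> 'a"
  assumes "connected_graded_algebra K A"
    and "d > 0" and "f \<in> grade A d"
    and "normal_element A f" and "regular_element A f"
    and "\<sigma> = normalizing_automorphism K A f"
    and "\<zeta> = twisting_system_of A \<sigma>"
  shows "equivalent_categories
    (TMF K A f :: (('a, 'm) factorization, ('m \<Rightarrow> 'm) \<times> ('m \<Rightarrow> 'm)) cat)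
    (TMF K (zhang_twist A \<zeta>) f :: (('a, 'm) factorization, ('m \<Rightarrow> 'm) \<times> ('m \<Rightarrow> 'm)) cat)"
proof -
  have "twisted_factorizations A (zhang_twist A \<zeta>) \<zeta> K f"
    unfolding assms(6,7) by (rule twisted_factorizations_zhang_twist) (use assms in auto)
  then show ?thesis
    by (rule twisted_factorizations.equivalent_categories_twist)
qed

end
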